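(* Let $d\ge 2$. Suppose that $E$ is a compact subset of $\mathbb{R}^d$ of the form $A_1\times A_2\times\dots\times A_d$, where $A_j\subset\mathbb{R}$ has positive $s_j$-dimensional Hausdorff measure for all $1\le j\le d$. Suppose that $\sum_{j=1}^d s_j>\frac{d^2}{2d-1}$. Then the Lebesgue measure of $\Delta(E)$ is positive.
   Context: For $E\subset\mathbb{R}^d$, the distance set is $\Delta(E)=\{|x-y|: x,y\in E\}\subset[0,\infty)$, where $|\cdot|$ is the Euclidean norm; its Lebesgue measure is one-dimensional Lebesgue measure. *)

theory Defs
  imports "HOL-Analysis.Analysis"
begin

text \<open>
  The quantity $(\mathrm{diam}\, U)^s$, with the conventions
  $(\mathrm{diam}\, \emptyset)^s = 0$ and $(\mathrm{diam}\, U)^0 = 1$ for nonempty \<open>U\<close>.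
  The case \<open>s = 0\<close> is separate because \<open>0 powr 0 = 0\<close>, which would give points
  zero counting measure.
\<close>

definition diam_powr :: "real \<Rightarrow> 'a::metric_space set \<Rightarrow> ennreal" where
  "diam_powr s U =
     (if U = {} then 0 else if s = 0 then 1 else ennreal (diameter U powr s))"

text \<open>
  Countable covers are sequences of sets; finite covers are padded with \<open>{}\<close>.
  Boundedness is required explicitly because \<^const>\<open>diameter\<close> is a real-valued
  supremum, with no meaningful value on unbounded sets.
\<close>

definition delta_covers :: "real \<Rightarrow> 'a::metric_space set \<Rightarrow> (nat \<Rightarrow> 'a set) set" where
  "delta_covers \<delta> A =
     {U. A \<subseteq> (\<Union>n. U n) \<and> (\<forall>n. bounded (U n) \<and> diameter (U n) \<le> \<delta>)}"

text \<open>
  The \<open>s\<close>-dimensional Hausdorff (outer) measure for \<open>s \<ge> 0\<close>, without a normalizing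
  constant: $\mathcal H^s(A) = \sup_{\delta > 0} \inf \sum_n (\mathrm{diam}\, U_n)^s$.
\<close>

definition hausdorff_measure :: "real \<Rightarrow> 'a::metric_space set \<Rightarrow> ennreal" where
  "hausdorff_measure s A =
     (SUP \<delta>\<in>{0<..}. INF U\<in>delta_covers \<delta> A. \<Sum>n. diam_powr s (U n))"

definition distance_set :: "'a::real_normed_vector set \<Rightarrow> real set" where
  "distance_set E = {norm (x - y) | x y. x \<in> E \<and> y \<in> E}"

end

theory Submission
  imports Defs
begin

text \<open>
  Let \<open>j0\<close> be the coordinate with the smallest \<open>s j0\<close>, and fix the \<open>j0\<close>-th coordinate \<open>a\<close> of the pin.
  Then $|x-y|^2 = (|x'|^2 + (x_{j0}-a)^2) - 2 x'\cdot y' + |y'|^2$, where $x'$ and $y'$ are the remaining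
  coordinates, so the pinned distances are projections of the lifted set
  $\{(x', |x'|^2+(x_{j0}-a)^2)\} \subset \mathbb R^d$, of dimension $\alpha = \sum_j s_j$, in the directions
  $(-2y',1)$, which form a set of dimension $\beta = \alpha - s_{j0}$. Falconer's estimate for exceptional
  projections needs $\alpha + \beta > d$, and $s_{j0} \le \alpha/d$ turns this into $\alpha > d^2/(2d-1)$.

  Everything is done on the grid of mesh $2^{-n}$ with bounds uniform in \<open>n\<close>: Frostman measures become finite
  weights, and the Fourier transform of the lifted measure becomes a finite exponential sum, estimated over
  the dyadic ranges of the frequency. If the distance set were null, the compact set of its squares would lie
  in an open set of small measure, which cannot contain the many grid cells hit at a fine enough scale.
\<close>

section \<open>Exponential sums\<close>

text \<open>The condition on the dimensions can be read off at a single frequency scale R = 2^i.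
  About R^d unit cubes of lifted frequencies have size R, and over them the squared Fourier
  transform of the lifted measure averages to at most a multiple of R^(-\<alpha>). A given cube is
  reached only from a set of pins of mass at most a multiple of R^(-\<beta>). So this scale
  contributes R^(d - \<alpha> - \<beta>), and the scales sum to a bound free of n when \<alpha> +
  \<beta> > d. The obstacle is that the pins may form a null set: an L2 bound over all frequencies
  says nothing about the frequencies t(-2y', 1) until each value has been spread over a cube around
  it. Time t and the pin y' are an integer and a grid point, so t y' is again a lattice frequency
  and the argument stays finite. Small energy yields many distances by Cauchy-Schwarz: a mass of 1
  whose cell masses have squares summing to at most K/N occupies at least N/K cells.\<close>

definition dirichlet :: "nat \<Rightarrow> real \<Rightarrow> complex" where
  "dirichlet K \<theta> = (\<Sum>t<K. cis (real t * \<theta>))"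

lemma norm_dirichlet_le: "norm (dirichlet K \<theta>) \<le> real K"
proof -
  have "norm (dirichlet K \<theta>) \<le> (\<Sum>t<K. norm (cis (real t * \<theta>)))"
    unfolding dirichlet_def by (rule norm_sum)
  then show ?thesis by simp
qed

lemma abs_le_2_abs_sin:
  fixes \<theta> :: real assumes "\<bar>\<theta>\<bar> \<le> 1" shows "\<bar>\<theta>\<bar> \<le> 2 * \<bar>sin \<theta>\<bar>"
proof -
  have *: "x \<le> 2 * sin x" if "0 \<le> x" "x \<le> 1" for x :: real
  proof -
    \<comment> \<open>Since 1 < pi/3, the cosine is at least 1/2 on [0, 1], so 2 sin x - x is
      nondecreasing there.\<close>
    have "0 \<le> cos y * 2 - 1" if "0 \<le> y" "y \<le> 1" for y :: real
    proof -
      have "cos (pi/3) \<le> cos y"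
        by (rule cos_monotone_0_pi_le) (use that pi_gt3 in auto)
      then show ?thesis by (simp add: cos_60)
    qed
    then have "2 * sin 0 - (0::real) \<le> 2 * sin x - x"
      by (intro DERIV_nonneg_imp_nondecreasing[OF that(1), of "\<lambda>x. 2 * sin x - x"])
        (use that in \<open>auto intro!: exI derivative_eq_intros\<close>)
    then show ?thesis by simp
  qed
  show ?thesis
  proof (cases "\<theta> \<ge> 0")
    case True
    then show ?thesis using *[of \<theta>] assms by (simp add: abs_if)
  next
    case False
    then show ?thesis using *[of "-\<theta>"] assms by (simp add: abs_if)
  qed
qed

text \<open>17 = 1 + 16: the squares of the trivial bound \<open>K\<close> and of the geometric sum
  bound 4/|\<theta>| are combined. The form with \<open>1 + (real K * \<theta>)\<^sup>2\<close>
  avoids a case split and is the kernel that is later summed against the weights.\<close>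

lemma dirichlet_bound:
  assumes "\<bar>\<theta>\<bar> \<le> 1"
  shows "(norm (dirichlet K \<theta>))\<^sup>2 \<le> 17 * (real K)\<^sup>2 / (1 + (real K * \<theta>)\<^sup>2)"
proof -
  have "(\<Sum>t<K. cis \<theta> ^ t) * (1 - cis \<theta>) = 1 - cis \<theta> ^ K"
    by (metis (no_types) mult.commute one_diff_power_eq)
  then have tel: "dirichlet K \<theta> * (1 - cis \<theta>) = 1 - cis (real K * \<theta>)"
    by (simp add: dirichlet_def Complex.DeMoivre)
  have "\<bar>sin \<theta>\<bar> \<le> norm (1 - cis \<theta>)"
    using abs_Im_le_cmod[of "1 - cis \<theta>"] by simp
  with abs_le_2_abs_sin[OF assms] have "\<bar>\<theta>\<bar> \<le> 2 * norm (1 - cis \<theta>)" by linarith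
  then have "norm (dirichlet K \<theta>) * \<bar>\<theta>\<bar> \<le> 2 * norm (dirichlet K \<theta> * (1 - cis \<theta>))"
    using mult_left_mono[of "\<bar>\<theta>\<bar>" "2 * norm (1 - cis \<theta>)" "norm (dirichlet K \<theta>)"]
    by (simp add: norm_mult)
  also have "norm (dirichlet K \<theta> * (1 - cis \<theta>)) \<le> 2"
    unfolding tel using norm_triangle_ineq4[of 1 "cis (real K * \<theta>)"] by simp
  finally have "norm (dirichlet K \<theta>) * \<bar>\<theta>\<bar> \<le> 4" by simp
  then have "(norm (dirichlet K \<theta>) * \<bar>\<theta>\<bar>)\<^sup>2 \<le> 4\<^sup>2"
    by (intro power_mono) auto
  then have "(norm (dirichlet K \<theta>))\<^sup>2 * \<theta>\<^sup>2 \<le> 16"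
    by (simp add: power_mult_distrib)
  then have "(norm (dirichlet K \<theta>))\<^sup>2 * \<theta>\<^sup>2 * (real K)\<^sup>2 \<le> 16 * (real K)\<^sup>2"
    by (intro mult_right_mono) auto
  moreover have "(norm (dirichlet K \<theta>))\<^sup>2 \<le> (real K)\<^sup>2"
    by (intro power_mono norm_dirichlet_le) auto
  ultimately have "(norm (dirichlet K \<theta>))\<^sup>2 + (norm (dirichlet K \<theta>))\<^sup>2 * \<theta>\<^sup>2 * (real K)\<^sup>2
      \<le> 17 * (real K)\<^sup>2" by linarith
  then have "(norm (dirichlet K \<theta>))\<^sup>2 * (1 + (real K * \<theta>)\<^sup>2) \<le> 17 * (real K)\<^sup>2"
    by (simp add: power_mult_distrib distrib_left mult_ac)
  then show ?thesis
    by (simp add: pos_le_divide_eq add_pos_nonneg)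
qed

lemma cis_Re_ge_half:
  assumes "\<bar>x\<bar> \<le> 1" shows "1/2 \<le> Re (cis x)"
proof -
  have "cos (pi/3) \<le> cos \<bar>x\<bar>"
    by (rule cos_monotone_0_pi_le) (use assms pi_gt3 in auto)
  then show ?thesis by (simp add: cos_60)
qed

lemma dirichlet_lower:
  assumes "real K * \<bar>\<theta>\<bar> \<le> 1"
  shows "real K / 2 \<le> norm (dirichlet K \<theta>)"
proof -
  have "(1/2::real) \<le> Re (cis (real t * \<theta>))" if "t < K" for t
  proof (rule cis_Re_ge_half)
    have "\<bar>real t * \<theta>\<bar> \<le> real K * \<bar>\<theta>\<bar>"
      using that by (simp add: abs_mult mult_right_mono)
    then show "\<bar>real t * \<theta>\<bar> \<le> 1" using assms by linarith
  qed
  then have "(\<Sum>t<K. 1/2::real) \<le> (\<Sum>t<K. Re (cis (real t * \<theta>)))"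
    by (intro sum_mono) auto
  also have "\<dots> = Re (dirichlet K \<theta>)" by (simp add: dirichlet_def)
  also have "\<dots> \<le> norm (dirichlet K \<theta>)" by (rule complex_Re_le_cmod)
  finally show ?thesis by simp
qed

lemma sum_inverse_one_plus_square_le: "(\<Sum>b<n. 1 / (1 + (real b)\<^sup>2)) \<le> 4"
proof -
  \<comment> \<open>The subtracted term makes the induction telescope: 1/(1 + m^2) is at most 2/m -
    2/(m + 1) for m \<ge> 1.\<close>
  have "(\<Sum>b<Suc n. 1 / (1 + (real b)\<^sup>2)) \<le> 4 - 2 / real (Suc n)" for n
  proof (induction n)
    case 0
    then show ?case by simp
  next
    case (Suc n)
    have "1 / (1 + (real (Suc n))\<^sup>2) \<le> 2 / real (Suc n) - 2 / real (Suc (Suc n))"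
    proof -
      have "2 / real (Suc n) - 2 / real (Suc (Suc n)) = 2 / (real (Suc n) * real (Suc (Suc n)))"
        by (simp add: field_simps)
      also have "1 / (1 + (real (Suc n))\<^sup>2) \<le> \<dots>"
      proof -
        have "real (Suc n) * real (Suc (Suc n)) \<le> 2 * (1 + (real (Suc n))\<^sup>2)"
          by (simp add: algebra_simps power2_eq_square)
        moreover have "0 < real (Suc n) * real (Suc (Suc n))" "0 < 1 + (real (Suc n))\<^sup>2"
          by (simp_all add: add_pos_nonneg)
        ultimately show ?thesis by (simp add: divide_simps del: of_nat_Suc)
      qed
      finally show ?thesis .
    qed
    with Suc show ?case by simp
  qed
  from this[of n] show ?thesis
    by (simp add: add_nonneg_nonneg) (smt (verit) divide_nonneg_nonneg zero_le_power2 of_nat_0_le_iff)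
qed

text \<open>Cut the line into cells of length \<open>1 / R\<close> counted from
  \<open>\<tau>\<close>. On the b-th cell to either side the kernel is at most 1/(1 + b^2), and
  these values sum to at most 4; with two sides this gives 8.\<close>

lemma sum_decaying_kernel_le:
  fixes q v :: "'a \<Rightarrow> real"
  assumes fin: "finite X" and q: "\<And>k. k \<in> X \<Longrightarrow> 0 \<le> q k" and R: "R > 0"
    and M: "\<And>b. (\<Sum>k | k \<in> X \<and> b \<le> v k \<and> v k < b + 1 / R. q k) \<le> M"
  shows "(\<Sum>k\<in>X. q k * (1 / (1 + (R * (\<tau> - v k))\<^sup>2))) \<le> 8 * M"
proof -
  define a where "a k = \<lfloor>R * (v k - \<tau>)\<rfloor>" for k
  \<comment> \<open>Cells \<open>a\<close> and \<open>- a - 1\<close> lie symmetrically about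
    \<open>\<tau>\<close>; they get the same index, a lower bound for the distance to
    \<open>\<tau>\<close> in units of \<open>1 / R\<close>.\<close>
  define fl where "fl k = nat (if a k \<ge> 0 then a k else - a k - 1)" for k
  obtain B where B: "\<And>k. k \<in> X \<Longrightarrow> fl k < B"
    using fin by (metis finite_nat_set_iff_bounded finite_imageI imageI)
  have M0: "0 \<le> M"
    using M[of 0] sum_nonneg[of "{k \<in> X. 0 \<le> v k \<and> v k < 0 + 1/R}" q] q by force
  have a: "of_int (a k) \<le> R * (v k - \<tau>)" "R * (v k - \<tau>) < of_int (a k) + 1" for k
    unfolding a_def by linarith+
  have fl: "real (fl k) \<le> \<bar>R * (\<tau> - v k)\<bar>" for k
  proof (cases "a k \<ge> 0")
    case True
    then show ?thesis using a[of k] by (simp add: fl_def algebra_simps)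
  next
    case False
    then have "real (fl k) = - of_int (a k) - 1" by (simp add: fl_def of_nat_nat)
    then show ?thesis using a[of k] by (simp add: algebra_simps)
  qed
  have "(\<Sum>k\<in>X. q k * (1 / (1 + (R * (\<tau> - v k))\<^sup>2))) \<le> (\<Sum>k\<in>X. q k * (1 / (1 + (real (fl k))\<^sup>2)))"
  proof (intro sum_mono mult_left_mono q divide_left_mono)
    fix k
    have "(real (fl k))\<^sup>2 \<le> \<bar>R * (\<tau> - v k)\<bar>\<^sup>2"
      using fl by (intro power_mono) auto
    then show "1 + (real (fl k))\<^sup>2 \<le> 1 + (R * (\<tau> - v k))\<^sup>2"
      by simp
  qed (auto simp: add_pos_nonneg)
  also have "\<dots> = (\<Sum>b<B. \<Sum>k | k \<in> X \<and> fl k = b. q k * (1 / (1 + (real (fl k))\<^sup>2)))"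
    by (rule sum.group[symmetric]) (use fin B in auto)
  also have "\<dots> = (\<Sum>b<B. (\<Sum>k | k \<in> X \<and> fl k = b. q k) * (1 / (1 + (real b)\<^sup>2)))"
    by (simp add: sum_divide_distrib)
  also have "\<dots> \<le> (\<Sum>b<B. (2 * M) * (1 / (1 + (real b)\<^sup>2)))"
  proof (intro sum_mono mult_right_mono)
    fix b
    let ?I = "\<lambda>a. {k. k \<in> X \<and> a \<le> v k \<and> v k < a + 1 / R}"
    define x1 where "x1 = \<tau> + real b / R"
    define x2 where "x2 = \<tau> - (real b + 1) / R"
    have sub: "{k. k \<in> X \<and> fl k = b} \<subseteq> ?I x1 \<union> ?I x2"
    proof
      fix k assume "k \<in> {k. k \<in> X \<and> fl k = b}"
      then have k: "k \<in> X" and b: "fl k = b" by auto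
      show "k \<in> ?I x1 \<union> ?I x2"
      proof (cases "a k \<ge> 0")
        case True
        then have "real b = of_int (a k)" using b by (simp add: fl_def)
        then show ?thesis using a[of k] R k by (simp add: x1_def field_simps)
      next
        case False
        then have "real b + 1 = - of_int (a k)" using b by (auto simp: fl_def of_nat_nat)
        then have x2: "x2 = \<tau> + of_int (a k) / R" by (simp add: x2_def)
        moreover have "x2 + 1 / R = \<tau> + (of_int (a k) + 1) / R"
          using x2 by (simp add: add_divide_distrib)
        moreover have "of_int (a k) / R \<le> v k - \<tau>" "v k - \<tau> < (of_int (a k) + 1) / R"
          using a[of k] R by (simp_all add: field_simps)
        ultimately show ?thesis using k by auto
      qed
    qed
    have "(\<Sum>k | k \<in> X \<and> fl k = b. q k) \<le> sum q (?I x1 \<union> ?I x2)"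
      by (rule sum_mono2) (use sub fin q in auto)
    also have "\<dots> \<le> sum q (?I x1) + sum q (?I x2)"
      using sum_nonneg[of "?I x1 \<inter> ?I x2" q] q fin
      by (subst sum_Un) auto
    also have "\<dots> \<le> 2 * M" using M[of x1] M[of x2] by simp
    finally show "(\<Sum>k | k \<in> X \<and> fl k = b. q k) \<le> 2 * M" .
  qed auto
  also have "\<dots> = 2 * M * (\<Sum>b<B. 1 / (1 + (real b)\<^sup>2))"
    by (simp add: sum_distrib_left)
  also have "\<dots> \<le> 2 * M * 4"
    using M0 by (intro mult_left_mono sum_inverse_one_plus_square_le) auto
  finally show ?thesis by simp
qed

section \<open>Fejer majorants and the double large sieve\<close>

text \<open>Each m with |m| < K is a difference of elements of {0, ..., 2K - 1} in 2K - |m| ways,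
  which is more than K. Replacing the sharp cutoff by differences brings the sum into the form to
  which \<open>double_large_sieve\<close> applies.\<close>

lemma fejer_majorant_int:
  fixes H :: "int \<Rightarrow> real"
  assumes H: "\<And>m. 0 \<le> H m"
  shows "real K * (\<Sum>m\<in>{- int K<..<int K}. H m) \<le> (\<Sum>(a, b)\<in>{..<2 * K} \<times> {..<2 * K}. H (int a - int b))"
proof -
  have "(\<Sum>(m, t)\<in>{- int K<..<int K} \<times> {..<K}. H m) \<le> (\<Sum>(a, b)\<in>{..<2 * K} \<times> {..<2 * K}. H (int a - int b))"
  \<comment> \<open>The K representations of \<open>m\<close> are the shifts by \<open>t\<close> of
    its positive and negative parts. One of these parts is 0, so the minimum recovers
    \<open>t\<close>.\<close>
  proof (rule sum_le_included[where i = "\<lambda>(a, b). (int a - int b, min a b)"])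
    show "\<forall>x\<in>{- int K<..<int K} \<times> {..<K}. \<exists>y\<in>{..<2 * K} \<times> {..<2 * K}.
        (case y of (a, b) \<Rightarrow> (int a - int b, min a b)) = x \<and> (case x of (m, t) \<Rightarrow> H m) \<le> (case y of (a, b) \<Rightarrow> H (int a - int b))"
    proof (intro ballI)
      fix x assume "x \<in> {- int K<..<int K} \<times> {..<K}"
      then obtain m t where x: "x = (m, t)" and "m \<in> {- int K<..<int K}" "t \<in> {..<K}" by auto
      then show "\<exists>y\<in>{..<2 * K} \<times> {..<2 * K}. (case y of (a, b) \<Rightarrow> (int a - int b, min a b)) = x
          \<and> (case x of (m, t) \<Rightarrow> H m) \<le> (case y of (a, b) \<Rightarrow> H (int a - int b))"
        by (intro bexI[of _ "(t + nat m, t + nat (- m))"]) auto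
    qed
  qed (auto simp: H)
  then show ?thesis
    by (simp add: sum.cartesian_product[symmetric] sum_distrib_left)
qed

lemma fejer_majorant_PiE:
  fixes H :: "('j \<Rightarrow> int) \<Rightarrow> real"
  assumes J: "finite J" and H: "\<And>m. 0 \<le> H m"
  shows "real K ^ card J * (\<Sum>m\<in>PiE J (\<lambda>_. {- int K<..<int K}). H m)
    \<le> (\<Sum>(a, b)\<in>PiE J (\<lambda>_. {..<2 * K}) \<times> PiE J (\<lambda>_. {..<2 * K}). H (restrict (\<lambda>j. int (a j) - int (b j)) J))"
    (is "_ \<le> ?rhs")
proof -
  have "(\<Sum>(m, t)\<in>PiE J (\<lambda>_. {- int K<..<int K}) \<times> PiE J (\<lambda>_. {..<K}). H m) \<le> ?rhs"
  proof (rule sum_le_included[where i = "\<lambda>(a, b). (restrict (\<lambda>j. int (a j) - int (b j)) J, restrict (\<lambda>j. min (a j) (b j)) J)"])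
    show "\<forall>x\<in>PiE J (\<lambda>_. {- int K<..<int K}) \<times> PiE J (\<lambda>_. {..<K}). \<exists>y\<in>PiE J (\<lambda>_. {..<2 * K}) \<times> PiE J (\<lambda>_. {..<2 * K}).
       (case y of (a, b) \<Rightarrow> (restrict (\<lambda>j. int (a j) - int (b j)) J, restrict (\<lambda>j. min (a j) (b j)) J)) = x
       \<and> (case x of (m, t) \<Rightarrow> H m) \<le> (case y of (a, b) \<Rightarrow> H (restrict (\<lambda>j. int (a j) - int (b j)) J))"
    proof clarify
      fix m :: "'j \<Rightarrow> int" and t
      assume m: "m \<in> PiE J (\<lambda>_. {- int K<..<int K})" and t: "t \<in> PiE J (\<lambda>_. {..<K})"
      let ?a = "restrict (\<lambda>j. t j + nat (m j)) J"
      let ?b = "restrict (\<lambda>j. t j + nat (- m j)) J"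
      have eq: "restrict (\<lambda>j. int (?a j) - int (?b j)) J = m"
        using m by (intro ext) (auto simp: PiE_def extensional_def)
      have eq': "restrict (\<lambda>j. min (?a j) (?b j)) J = t"
        using t by (intro ext) (auto simp: PiE_def extensional_def)
      have a: "?a j < 2 * K" "?b j < 2 * K" if "j \<in> J" for j
        using PiE_mem[OF m that] PiE_mem[OF t that] that by auto
      show "\<exists>y\<in>PiE J (\<lambda>_. {..<2 * K}) \<times> PiE J (\<lambda>_. {..<2 * K}).
       (case y of (a, b) \<Rightarrow> (restrict (\<lambda>j. int (a j) - int (b j)) J, restrict (\<lambda>j. min (a j) (b j)) J)) = (m, t)
       \<and> H m \<le> (case y of (a, b) \<Rightarrow> H (restrict (\<lambda>j. int (a j) - int (b j)) J))"
        by (rule bexI[of _ "(?a, ?b)"]) (use eq eq' a in auto)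
    qed
  qed (use J in \<open>auto simp: H intro!: finite_PiE\<close>)
  then show ?thesis
    by (simp add: sum.cartesian_product[symmetric] sum_distrib_left card_PiE J)
qed

text \<open>Expanding the square and interchanging sums gives an identity with
  \<open>w a * cnj (w b)\<close>; the inequality is only the triangle inequality. It serves in both
  directions: from lifted frequencies to pairs of points, and from pairs of points with close values
  of \<open>f y\<close> back to frequencies.\<close>

lemma double_large_sieve:
  fixes w :: "'a \<Rightarrow> complex" and e :: "'a \<Rightarrow> 'y \<Rightarrow> complex"
  shows "(\<Sum>(y, y')\<in>Y \<times> Y. (norm (\<Sum>a\<in>X. w a * (e a y * cnj (e a y'))))\<^sup>2)
    \<le> (\<Sum>a\<in>X. \<Sum>b\<in>X. norm (w a) * norm (w b) * (norm (\<Sum>y\<in>Y. e a y * cnj (e b y)))\<^sup>2)" (is "?L \<le> ?R")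
proof -
  have "complex_of_real ?L = (\<Sum>y\<in>Y. \<Sum>y'\<in>Y. (\<Sum>a\<in>X. w a * (e a y * cnj (e a y'))) * (\<Sum>b\<in>X. cnj (w b) * (cnj (e b y) * e b y')))"
    by (simp add: sum.cartesian_product[symmetric] of_real_sum complex_norm_square del: of_real_power)
  also have "\<dots> = (\<Sum>y\<in>Y. \<Sum>y'\<in>Y. \<Sum>a\<in>X. \<Sum>b\<in>X. w a * cnj (w b) * ((e a y * cnj (e b y)) * cnj (e a y' * cnj (e b y'))))"
    unfolding sum_product by (intro sum.cong refl) (simp add: mult_ac)
  also have "\<dots> = (\<Sum>y\<in>Y. \<Sum>a\<in>X. \<Sum>y'\<in>Y. \<Sum>b\<in>X. w a * cnj (w b) * ((e a y * cnj (e b y)) * cnj (e a y' * cnj (e b y'))))"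
    by (intro sum.cong refl sum.swap)
  also have "\<dots> = (\<Sum>a\<in>X. \<Sum>y\<in>Y. \<Sum>b\<in>X. \<Sum>y'\<in>Y. w a * cnj (w b) * ((e a y * cnj (e b y)) * cnj (e a y' * cnj (e b y'))))"
    by (subst sum.swap) (intro sum.cong refl sum.swap)
  also have "\<dots> = (\<Sum>a\<in>X. \<Sum>b\<in>X. \<Sum>y\<in>Y. \<Sum>y'\<in>Y. w a * cnj (w b) * ((e a y * cnj (e b y)) * cnj (e a y' * cnj (e b y'))))"
    by (intro sum.cong refl sum.swap)
  also have "\<dots> = (\<Sum>a\<in>X. \<Sum>b\<in>X. w a * cnj (w b) * ((\<Sum>y\<in>Y. e a y * cnj (e b y)) * cnj (\<Sum>y\<in>Y. e a y * cnj (e b y))))"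
    unfolding cnj_sum sum_product by (simp only: sum_distrib_left)
  also have "\<dots> = (\<Sum>a\<in>X. \<Sum>b\<in>X. w a * cnj (w b) * of_real ((norm (\<Sum>y\<in>Y. e a y * cnj (e b y)))\<^sup>2))"
    by (simp only: complex_norm_square)
  finally have eq: "complex_of_real ?L = \<dots>" .
  have "?L \<le> norm (complex_of_real ?L)" unfolding norm_of_real by (rule abs_ge_self)
  also have "\<dots> \<le> (\<Sum>a\<in>X. norm (\<Sum>b\<in>X. w a * cnj (w b) * of_real ((norm (\<Sum>y\<in>Y. e a y * cnj (e b y)))\<^sup>2)))"
    unfolding eq by (rule norm_sum)
  also have "\<dots> \<le> (\<Sum>a\<in>X. \<Sum>b\<in>X. norm (w a * cnj (w b) * of_real ((norm (\<Sum>y\<in>Y. e a y * cnj (e b y)))\<^sup>2)))"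
    by (intro sum_mono norm_sum)
  also have "\<dots> = ?R" by (simp add: norm_mult norm_power)
  finally show ?thesis .
qed

lemma cis_sum: "finite J \<Longrightarrow> cis (\<Sum>j\<in>J. f j) = (\<Prod>j\<in>J. cis (f j))"
  by (induction J rule: finite_induct) (auto simp: cis_mult[symmetric])

text \<open>After the Fejer majorants the frequencies are differences within a product set, so the
  inner character sum of \<open>double_large_sieve\<close> factors into one Dirichlet kernel per
  coordinate.\<close>

lemma exponential_sum_box_bound:
  fixes w :: "'a \<Rightarrow> complex" and g :: "'a \<Rightarrow> real" and u :: "'j \<Rightarrow> 'a \<Rightarrow> real"
  assumes J: "finite J"
  shows "real K0 * real K ^ card J *
      (\<Sum>\<tau>\<in>{- int K0<..<int K0}. \<Sum>m\<in>PiE J (\<lambda>_. {- int K<..<int K}).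
         (norm (\<Sum>a\<in>X. w a * cis (of_int \<tau> * g a + (\<Sum>j\<in>J. of_int (m j) * u j a))))\<^sup>2)
    \<le> (\<Sum>a\<in>X. \<Sum>b\<in>X. norm (w a) * norm (w b) *
         ((norm (dirichlet (2 * K0) (g a - g b)))\<^sup>2 * (\<Prod>j\<in>J. (norm (dirichlet (2 * K) (u j a - u j b)))\<^sup>2)))"
proof -
  let ?B = "PiE J (\<lambda>_. {- int K<..<int K})"
  let ?T = "{..<2 * K0}" and ?P = "PiE J (\<lambda>_. {..<2 * K})"
  define F where "F \<tau> m = (norm (\<Sum>a\<in>X. w a * cis (of_int \<tau> * g a + (\<Sum>j\<in>J. of_int (m j) * u j a))))\<^sup>2"
    for \<tau> m
  define e where "e a = (\<lambda>(t::nat, \<alpha>::'j \<Rightarrow> nat). cis (real t * g a + (\<Sum>j\<in>J. real (\<alpha> j) * u j a)))" for a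
  have F0: "0 \<le> F \<tau> m" for \<tau> m by (simp add: F_def)
  have "real K0 * real K ^ card J * (\<Sum>\<tau>\<in>{- int K0<..<int K0}. \<Sum>m\<in>?B. F \<tau> m)
     = real K ^ card J * (\<Sum>m\<in>?B. real K0 * (\<Sum>\<tau>\<in>{- int K0<..<int K0}. F \<tau> m))"
    by (subst sum.swap) (simp add: sum_distrib_left mult_ac)
  also have "\<dots> \<le> real K ^ card J * (\<Sum>m\<in>?B. \<Sum>(t, t')\<in>?T \<times> ?T. F (int t - int t') m)"
    by (intro mult_left_mono sum_mono fejer_majorant_int F0) auto
  also have "\<dots> = (\<Sum>(t, t')\<in>?T \<times> ?T. real K ^ card J * (\<Sum>m\<in>?B. F (int t - int t') m))"
    by (subst sum.swap) (simp add: sum_distrib_left case_prod_unfold)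
  also have "\<dots> \<le> (\<Sum>(t, t')\<in>?T \<times> ?T. \<Sum>(\<alpha>, \<beta>)\<in>?P \<times> ?P. F (int t - int t') (restrict (\<lambda>j. int (\<alpha> j) - int (\<beta> j)) J))"
    unfolding case_prod_unfold
    by (intro sum_mono fejer_majorant_PiE[OF J, unfolded case_prod_unfold] F0)
  also have "\<dots> = (\<Sum>t\<in>?T. \<Sum>\<alpha>\<in>?P. \<Sum>t'\<in>?T. \<Sum>\<beta>\<in>?P. F (int t - int t') (restrict (\<lambda>j. int (\<alpha> j) - int (\<beta> j)) J))"
    by (simp add: sum.cartesian_product[symmetric]) (intro sum.cong refl sum.swap)
  also have "\<dots> = (\<Sum>(y, y')\<in>(?T \<times> ?P) \<times> (?T \<times> ?P). (norm (\<Sum>a\<in>X. w a * (e a y * cnj (e a y'))))\<^sup>2)"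
  proof -
    have "F (int t - int t') (restrict (\<lambda>j. int (\<alpha> j) - int (\<beta> j)) J)
      = (norm (\<Sum>a\<in>X. w a * (e a (t, \<alpha>) * cnj (e a (t', \<beta>)))))\<^sup>2" for t t' \<alpha> \<beta>
      by (simp add: F_def e_def cis_cnj cis_mult algebra_simps sum_subtractf cong: sum.cong)
    then show ?thesis by (simp only: sum.cartesian_product' split_def fst_conv snd_conv)
  qed
  also have "\<dots> \<le> (\<Sum>a\<in>X. \<Sum>b\<in>X. norm (w a) * norm (w b) * (norm (\<Sum>y\<in>?T \<times> ?P. e a y * cnj (e b y)))\<^sup>2)"
    by (rule double_large_sieve)
  also have "\<dots> = (\<Sum>a\<in>X. \<Sum>b\<in>X. norm (w a) * norm (w b) *
         ((norm (dirichlet (2 * K0) (g a - g b)))\<^sup>2 * (\<Prod>j\<in>J. (norm (dirichlet (2 * K) (u j a - u j b)))\<^sup>2)))"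
  proof (intro sum.cong refl arg_cong2[where f = "(*)"])
    fix a b
    have "(\<Sum>y\<in>?T \<times> ?P. e a y * cnj (e b y))
       = (\<Sum>t\<in>?T. \<Sum>\<alpha>\<in>?P. cis (real t * (g a - g b)) * (\<Prod>j\<in>J. cis (real (\<alpha> j) * (u j a - u j b))))"
      unfolding sum.cartesian_product
      by (intro sum.cong refl)
        (simp add: e_def case_prod_unfold cis_cnj cis_mult cis_sum[OF J, symmetric] algebra_simps sum_subtractf)
    also have "\<dots> = dirichlet (2 * K0) (g a - g b) * (\<Prod>j\<in>J. dirichlet (2 * K) (u j a - u j b))"
      unfolding dirichlet_def using J
      by (subst prod_sum_PiE) (auto simp: sum_product)
    finally show "(norm (\<Sum>y\<in>?T \<times> ?P. e a y * cnj (e b y)))\<^sup>2 = (norm (dirichlet (2 * K0) (g a - g b)))\<^sup>2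
        * (\<Prod>j\<in>J. (norm (dirichlet (2 * K) (u j a - u j b)))\<^sup>2)"
      by (simp add: norm_mult prod_norm[symmetric] power_mult_distrib prod_power_distrib)
  qed
  finally show ?thesis by (simp add: F_def)
qed

lemma inverse_one_plus_square_scale:
  fixes x y l :: real
  assumes "0 < l" "l \<le> 1" "l * \<bar>x\<bar> \<le> \<bar>y\<bar>"
  shows "1 / (1 + y\<^sup>2) \<le> (1 / l\<^sup>2) * (1 / (1 + x\<^sup>2))"
proof -
  have "(l * \<bar>x\<bar>)\<^sup>2 \<le> \<bar>y\<bar>\<^sup>2" using assms by (intro power_mono) auto
  then have "l\<^sup>2 * x\<^sup>2 \<le> y\<^sup>2" by (simp add: power_mult_distrib)
  moreover have "l\<^sup>2 \<le> 1" using assms by (simp add: power_le_one)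
  ultimately have "l\<^sup>2 * (1 + x\<^sup>2) \<le> 1 + y\<^sup>2" by (simp add: distrib_left)
  then have "1 / (1 + y\<^sup>2) \<le> 1 / (l\<^sup>2 * (1 + x\<^sup>2))"
    using assms by (intro divide_left_mono mult_pos_pos) (auto simp: add_pos_nonneg)
  then show ?thesis by simp
qed

lemma sum_dyadic_blocks:
  fixes h :: "nat \<Rightarrow> real"
  shows "(\<Sum>t\<in>{1..<2 ^ n}. h t) = (\<Sum>i<n. \<Sum>t\<in>{2 ^ i..<2 * 2 ^ i}. h t)"
proof (induction n)
  case (Suc n)
  have "(\<Sum>t\<in>{1..<2 ^ Suc n}. h t) = (\<Sum>t\<in>{1..<2 ^ n}. h t) + (\<Sum>t\<in>{2 ^ n..<2 ^ Suc n}. h t)"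
    by (rule sum.atLeastLessThan_concat[symmetric]) auto
  then show ?case using Suc by simp
qed simp

text \<open>For fixed \<open>t\<close>, each distance occurs at most once with \<open>t'\<close> on
  either side, whence the factor 2.\<close>

lemma sum_nat_distance_le:
  fixes h :: "nat \<Rightarrow> real"
  assumes h: "\<And>k. 0 \<le> h k"
  shows "(\<Sum>t<N. \<Sum>t'<N. h (nat \<bar>int t - int t'\<bar>)) \<le> 2 * real N * (\<Sum>k<N. h k)"
proof -
  have "(\<Sum>t'<N. h (nat \<bar>int t - int t'\<bar>)) \<le> 2 * (\<Sum>k<N. h k)" if t: "t < N" for t
  proof -
    have split: "{..<N} = {..t} \<union> {t<..<N}" using t by auto
    have "(\<Sum>t'<N. h (nat \<bar>int t - int t'\<bar>)) = (\<Sum>t'\<in>{..t}. h (nat \<bar>int t - int t'\<bar>)) + (\<Sum>t'\<in>{t<..<N}. h (nat \<bar>int t - int t'\<bar>))"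
      unfolding split by (rule sum.union_disjoint) auto
    also have "(\<Sum>t'\<in>{..t}. h (nat \<bar>int t - int t'\<bar>)) \<le> (\<Sum>k<N. h k)"
    proof (rule sum_le_included[where i = "\<lambda>k. t - k"])
      show "\<forall>x\<in>{..t}. \<exists>y\<in>{..<N}. t - y = x \<and> h (nat \<bar>int t - int x\<bar>) \<le> h y"
      proof
        fix x assume "x \<in> {..t}"
        then have "nat \<bar>int t - int x\<bar> = t - x" "t - (t - x) = x" "t - x < N" using t by auto
        then show "\<exists>y\<in>{..<N}. t - y = x \<and> h (nat \<bar>int t - int x\<bar>) \<le> h y" by (intro bexI[of _ "t - x"]) auto
      qed
    qed (auto simp: h)
    also have "(\<Sum>t'\<in>{t<..<N}. h (nat \<bar>int t - int t'\<bar>)) \<le> (\<Sum>k<N. h k)"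
    proof (rule sum_le_included[where i = "\<lambda>k. t + k"])
      show "\<forall>x\<in>{t<..<N}. \<exists>y\<in>{..<N}. t + y = x \<and> h (nat \<bar>int t - int x\<bar>) \<le> h y"
      proof
        fix x assume "x \<in> {t<..<N}"
        then have "nat \<bar>int t - int x\<bar> = x - t" "t + (x - t) = x" "x - t < N" by auto
        then show "\<exists>y\<in>{..<N}. t + y = x \<and> h (nat \<bar>int t - int x\<bar>) \<le> h y" by (intro bexI[of _ "x - t"]) auto
      qed
    qed (auto simp: h)
    finally show ?thesis by simp
  qed
  then have "(\<Sum>t<N. \<Sum>t'<N. h (nat \<bar>int t - int t'\<bar>)) \<le> (\<Sum>t<N. 2 * (\<Sum>k<N. h k))"
    by (intro sum_mono) auto
  then show ?thesis by simp
qed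

section \<open>The energy of pinned distances on the grid\<close>

text \<open>
  The weights \<open>p j\<close> serve both the points and the pins in the coordinates \<open>j \<in> J\<close>. In the remaining coordinate the
  pin is fixed, and \<open>v k\<close> stands for the squared distance from the grid point \<open>k\<close> to it.
\<close>

locale grid_weights =
  fixes J :: "'j set" and n :: nat and p :: "'j \<Rightarrow> nat \<Rightarrow> real" and q v :: "nat \<Rightarrow> real"
    and s :: "'j \<Rightarrow> real" and s0 C :: real
  assumes finite_J: "finite J" and C_ge_1: "C \<ge> 1"
    and p_nonneg: "\<And>j k. j \<in> J \<Longrightarrow> 0 \<le> p j k"
    and p_sum: "\<And>j. j \<in> J \<Longrightarrow> (\<Sum>k<2 ^ n. p j k) = 1"
    and p_ball: "\<And>j i b. j \<in> J \<Longrightarrow> i \<le> n \<Longrightarrow>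
        (\<Sum>k | k < 2 ^ n \<and> b \<le> real k / 2 ^ n \<and> real k / 2 ^ n < b + 1 / 2 ^ i. p j k) \<le> C * (1 / 2 ^ i) powr s j"
    and q_nonneg: "\<And>k. 0 \<le> q k"
    and q_sum: "(\<Sum>k<2 ^ n. q k) = 1"
    and q_ball: "\<And>i b. i \<le> n \<Longrightarrow>
        (\<Sum>k | k < 2 ^ n \<and> b \<le> v k \<and> v k < b + 1 / 2 ^ i. q k) \<le> C * (1 / 2 ^ i) powr s0"
    and v_unit: "\<And>k. k < 2 ^ n \<Longrightarrow> 0 \<le> v k \<and> v k \<le> 1"
begin

definition N :: nat where "N = 2 ^ n"
definition Y :: "('j \<Rightarrow> nat) set" where "Y = PiE J (\<lambda>_. {..<N})"
definition X :: "(('j \<Rightarrow> nat) \<times> nat) set" where "X = Y \<times> {..<N}"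
definition \<nu> :: "('j \<Rightarrow> nat) \<Rightarrow> real" where "\<nu> y = (\<Prod>j\<in>J. p j (y j))"
definition \<mu> :: "('j \<Rightarrow> nat) \<times> nat \<Rightarrow> real" where "\<mu> a = \<nu> (fst a) * q (snd a)"
text \<open>The extra coordinate of the lifted point. \<open>f y a\<close> differs from it by a term
  linear in \<open>fst a\<close> and a term free of \<open>a\<close>.\<close>

definition G :: "('j \<Rightarrow> nat) \<times> nat \<Rightarrow> real" where
  "G a = (\<Sum>j\<in>J. (real (fst a j) / real N)\<^sup>2) + v (snd a)"
definition f :: "('j \<Rightarrow> nat) \<Rightarrow> ('j \<Rightarrow> nat) \<times> nat \<Rightarrow> real" where
  "f y a = (\<Sum>j\<in>J. (real (fst a j) / real N - real (y j) / real N)\<^sup>2) + v (snd a)"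

text \<open>The phase constant \<open>c\<close> keeps \<open>c * \<bar>G a - G b\<bar> \<le> 1\<close>, away from the periods of \<open>cis\<close>.\<close>

definition c :: real where "c = 1 / (real (card J) + 1)"
text \<open>Divided by N^2 so that integer frequencies suffice: both \<open>fst a j\<close> and
  \<open>y j\<close> are grid indices, and at time \<open>t\<close> the cross term of the squared
  distance is \<open>u j a\<close> times the integer \<open>- 2 * t * y j\<close>. An integer step
  is therefore 1/N of a unit frequency.\<close>

definition u :: "'j \<Rightarrow> ('j \<Rightarrow> nat) \<times> nat \<Rightarrow> real" where
  "u j a = c * real (fst a j) / (real N)\<^sup>2"
text \<open>The Fourier transform, at frequency \<open>c * t\<close>, of the image of
  \<open>\<mu>\<close> under the pinned squared distance \<open>f y\<close>.\<close>

definition S :: "('j \<Rightarrow> nat) \<Rightarrow> nat \<Rightarrow> complex" where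
  "S y t = (\<Sum>a\<in>X. of_real (\<mu> a) * cis (real t * (c * f y a)))"

text \<open>
  \<open>\<gamma>\<close> averages characters over a unit cube of frequencies, and \<open>norm (\<gamma> a)\<close> is bounded below on \<open>X\<close>. Hence an
  exponential sum with weight \<open>\<mu> = w * \<gamma>\<close> at one frequency is an average over a unit cube of sums with weight \<open>w\<close>.
  This replaces the uncertainty principle for compactly supported measures.
\<close>

definition \<gamma> :: "('j \<Rightarrow> nat) \<times> nat \<Rightarrow> complex" where
  "\<gamma> a = (\<Prod>j\<in>J. dirichlet N (u j a) / of_nat N)"
definition w :: "('j \<Rightarrow> nat) \<times> nat \<Rightarrow> complex" where
  "w a = of_real (\<mu> a) / \<gamma> a"
definition F :: "int \<Rightarrow> ('j \<Rightarrow> int) \<Rightarrow> real" where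
  "F \<tau> m = (norm (\<Sum>a\<in>X. w a * cis (of_int \<tau> * (c * G a) + (\<Sum>j\<in>J. of_int (m j) * u j a))))\<^sup>2"

section \<open>Normalization and size bounds\<close>

lemma N_pos: "0 < N" by (simp add: N_def)
lemma real_N: "real N = 2 ^ n" by (simp add: N_def)
lemma finite_Y: "finite Y" by (simp add: Y_def finite_J finite_PiE)
lemma finite_X: "finite X" by (simp add: X_def finite_Y)
lemma card_Y: "card Y = N ^ card J" by (simp add: Y_def card_PiE finite_J)
lemma \<nu>_nonneg: "0 \<le> \<nu> y" by (simp add: \<nu>_def prod_nonneg p_nonneg)
lemma \<mu>_nonneg: "0 \<le> \<mu> a" by (simp add: \<mu>_def \<nu>_nonneg q_nonneg)
lemma Y_less: "y \<in> Y \<Longrightarrow> j \<in> J \<Longrightarrow> y j < N" by (auto simp: Y_def)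
lemma F_nonneg: "0 \<le> F \<tau> m" by (simp add: F_def)
lemma c_pos: "0 < c" and c_le_1: "c \<le> 1" by (simp_all add: c_def)

lemma \<nu>_sum: "(\<Sum>y\<in>Y. \<nu> y) = 1"
proof -
  have "(\<Sum>y\<in>Y. \<nu> y) = (\<Prod>j\<in>J. \<Sum>k<N. p j k)"
    unfolding Y_def \<nu>_def using finite_J by (subst prod_sum_PiE) auto
  then show ?thesis by (simp add: N_def p_sum)
qed

lemma \<mu>_sum: "(\<Sum>a\<in>X. \<mu> a) = 1"
  using \<nu>_sum q_sum by (simp add: X_def \<mu>_def sum.cartesian_product' sum_distrib_left[symmetric] N_def)

lemma G_bounds:
  assumes "a \<in> X" shows "0 \<le> G a" "G a \<le> real (card J) + 1"
proof -
  have "(real (fst a j) / real N)\<^sup>2 \<le> 1" if "j \<in> J" for j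
  proof -
    have "fst a j < N" using assms that by (auto simp: X_def Y_def)
    then show ?thesis using N_pos by (intro power_le_one) auto
  qed
  then have "(\<Sum>j\<in>J. (real (fst a j) / real N)\<^sup>2) \<le> (\<Sum>j\<in>J. 1)" by (intro sum_mono) auto
  moreover have "0 \<le> v (snd a) \<and> v (snd a) \<le> 1" using assms v_unit by (auto simp: X_def N_def)
  moreover have "0 \<le> (\<Sum>j\<in>J. (real (fst a j) / real N)\<^sup>2)" by (intro sum_nonneg) auto
  ultimately show "0 \<le> G a" "G a \<le> real (card J) + 1" unfolding G_def by auto
qed

lemma dirichlet_u_lower:
  assumes "a \<in> X" "j \<in> J" shows "1 / 2 \<le> norm (dirichlet N (u j a) / of_nat N)"
proof -
  have "fst a j < N" using assms by (auto simp: X_def Y_def)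
  then have "real (fst a j) / real N \<le> 1" using N_pos by simp
  then have "c * (real (fst a j) / real N) \<le> 1 * 1"
    using c_pos c_le_1 by (intro mult_mono) auto
  moreover have "real N * \<bar>u j a\<bar> = c * (real (fst a j) / real N)"
    using N_pos c_pos by (simp add: u_def power2_eq_square field_simps)
  ultimately have "real N * \<bar>u j a\<bar> \<le> 1" by simp
  then have "real N / 2 \<le> norm (dirichlet N (u j a))" by (rule dirichlet_lower)
  then show ?thesis using N_pos by (simp add: norm_divide field_simps)
qed

lemma \<gamma>_lower: assumes "a \<in> X" shows "(1 / 2) ^ card J \<le> norm (\<gamma> a)"
proof -
  have "(\<Prod>j\<in>J. 1 / 2 :: real) \<le> (\<Prod>j\<in>J. norm (dirichlet N (u j a) / of_nat N))"
    using dirichlet_u_lower[OF assms] by (intro prod_mono) auto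
  then show ?thesis by (simp add: \<gamma>_def prod_norm)
qed

lemma \<gamma>_nonzero: assumes "a \<in> X" shows "\<gamma> a \<noteq> 0"
  using \<gamma>_lower[OF assms] by (smt (verit) norm_zero zero_less_power half_gt_zero_iff)

lemma norm_w_le: assumes "a \<in> X" shows "norm (w a) \<le> 2 ^ card J * \<mu> a"
proof -
  have "norm (w a) = \<mu> a / norm (\<gamma> a)" by (simp add: w_def norm_divide \<mu>_nonneg)
  also have "\<dots> \<le> \<mu> a / (1 / 2) ^ card J"
    using \<gamma>_lower[OF assms] \<gamma>_nonzero[OF assms] by (intro divide_left_mono \<mu>_nonneg) auto
  finally show ?thesis by (simp add: power_divide mult.commute)
qed

text \<open>Here \<open>Y\<close> is not a set of pins but the cube of integer frequencies with
  sides \<open>{..<N}\<close>. It has side of order one in the rescaled coordinates, because of the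
  second factor \<open>1 / N\<close> in \<open>u\<close>.\<close>

lemma N_power_\<gamma>: "of_nat N ^ card J * \<gamma> a = (\<Sum>h\<in>Y. cis (\<Sum>j\<in>J. real (h j) * u j a))"
proof -
  have "of_nat N ^ card J * \<gamma> a = (\<Prod>j\<in>J. dirichlet N (u j a))"
    using N_pos by (simp add: \<gamma>_def prod_dividef)
  also have "\<dots> = (\<Sum>h\<in>Y. \<Prod>j\<in>J. cis (real (h j) * u j a))"
    unfolding dirichlet_def Y_def using finite_J by (subst prod_sum_PiE) auto
  finally show ?thesis by (simp add: cis_sum[OF finite_J])
qed

section \<open>From pinned distances to lifted frequencies\<close>

text \<open>Expanding the squares leaves |y'|^2 as the only term outside the lift. It is the same
  for all \<open>a\<close>, so it contributes just the unimodular factor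
  \<open>cis \<phi>\<close>.\<close>

lemma norm_S:
  assumes "y \<in> Y"
  shows "norm (S y t) = norm (\<Sum>a\<in>X. of_real (\<mu> a) * cis (real t * (c * G a) + (\<Sum>j\<in>J. - 2 * real t * real (y j) * u j a)))"
    (is "_ = norm ?T")
proof -
  define \<phi> where "\<phi> = real t * (c * (\<Sum>j\<in>J. (real (y j) / real N)\<^sup>2))"
  have "f y a = G a + (\<Sum>j\<in>J. - 2 * real (y j) * real (fst a j) / (real N)\<^sup>2) + (\<Sum>j\<in>J. (real (y j) / real N)\<^sup>2)" for a
  proof -
    have "(real (fst a j) / real N - real (y j) / real N)\<^sup>2 = (real (fst a j) / real N)\<^sup>2
        + - 2 * real (y j) * real (fst a j) / (real N)\<^sup>2 + (real (y j) / real N)\<^sup>2" for j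
      using N_pos by (simp add: field_simps power2_eq_square)
    then show ?thesis unfolding f_def G_def by (simp add: sum.distrib sum_subtractf sum_negf)
  qed
  then have "real t * (c * f y a) = real t * (c * G a)
      + real t * c * (\<Sum>j\<in>J. - 2 * real (y j) * real (fst a j) / (real N)\<^sup>2) + \<phi>" for a
    by (simp only: \<phi>_def distrib_left mult.assoc)
  moreover have "real t * c * (\<Sum>j\<in>J. - 2 * real (y j) * real (fst a j) / (real N)\<^sup>2)
      = (\<Sum>j\<in>J. - 2 * real t * real (y j) * u j a)" for a
    unfolding sum_distrib_left by (intro sum.cong refl) (simp add: u_def)
  ultimately have "real t * (c * f y a) = (real t * (c * G a) + (\<Sum>j\<in>J. - 2 * real t * real (y j) * u j a)) + \<phi>" for a
    by simp
  then have "S y t = ?T * cis \<phi>"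
    unfolding S_def sum_distrib_right by (simp only: cis_mult[symmetric] mult.assoc)
  then show ?thesis by (simp add: norm_mult)
qed

text \<open>By \<open>N_power_\<gamma>\<close> the sum is the mean of \<open>Z h\<close> over the
  frequency cube, and Cauchy-Schwarz bounds its square by the mean of the squares. The value at one
  frequency is thus controlled by a full cube, and the cubes of different pins can be
  counted.\<close>

lemma local_constancy:
  assumes y: "y \<in> Y"
  shows "(norm (S y t))\<^sup>2 \<le> (\<Sum>h\<in>Y. F (int t) (restrict (\<lambda>j. int (h j) - 2 * int t * int (y j)) J)) / real N ^ card J"
proof -
  let ?T = "\<Sum>a\<in>X. of_real (\<mu> a) * cis (real t * (c * G a) + (\<Sum>j\<in>J. - 2 * real t * real (y j) * u j a))"
  define Z where "Z h = (\<Sum>a\<in>X. w a * cis (real t * (c * G a) + (\<Sum>j\<in>J. (real (h j) - 2 * real t * real (y j)) * u j a)))" for h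
  have F: "F (int t) (restrict (\<lambda>j. int (h j) - 2 * int t * int (y j)) J) = (norm (Z h))\<^sup>2" for h
    by (simp add: F_def Z_def cong: sum.cong)
  have "of_nat N ^ card J * ?T
    = (\<Sum>a\<in>X. w a * (of_nat N ^ card J * \<gamma> a) * cis (real t * (c * G a) + (\<Sum>j\<in>J. - 2 * real t * real (y j) * u j a)))"
    unfolding sum_distrib_left by (intro sum.cong refl) (simp add: w_def \<gamma>_nonzero)
  also have "\<dots> = (\<Sum>a\<in>X. \<Sum>h\<in>Y. w a * cis (real t * (c * G a) + (\<Sum>j\<in>J. (real (h j) - 2 * real t * real (y j)) * u j a)))"
  proof (rule sum.cong[OF refl])
    fix a
    let ?Q = "real t * (c * G a) + (\<Sum>j\<in>J. - 2 * real t * real (y j) * u j a)"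
    have "cis (\<Sum>j\<in>J. real (h j) * u j a) * cis ?Q
        = cis (real t * (c * G a) + (\<Sum>j\<in>J. (real (h j) - 2 * real t * real (y j)) * u j a))" for h
      unfolding cis_mult by (intro arg_cong[where f = cis]) (simp add: left_diff_distrib sum_subtractf sum_negf)
    then have "w a * (\<Sum>h\<in>Y. cis (\<Sum>j\<in>J. real (h j) * u j a)) * cis ?Q
        = (\<Sum>h\<in>Y. w a * cis (real t * (c * G a) + (\<Sum>j\<in>J. (real (h j) - 2 * real t * real (y j)) * u j a)))"
      by (simp only: sum_distrib_left sum_distrib_right mult.assoc)
    then show "w a * (of_nat N ^ card J * \<gamma> a) * cis ?Q
        = (\<Sum>h\<in>Y. w a * cis (real t * (c * G a) + (\<Sum>j\<in>J. (real (h j) - 2 * real t * real (y j)) * u j a)))"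
      unfolding N_power_\<gamma> .
  qed
  also have "\<dots> = (\<Sum>h\<in>Y. Z h)" unfolding Z_def by (rule sum.swap)
  finally have eq: "of_nat N ^ card J * ?T = (\<Sum>h\<in>Y. Z h)" .
  have "real N ^ card J * norm (S y t) = norm (of_nat N ^ card J * ?T)"
    unfolding norm_S[OF y] by (simp only: norm_mult norm_power norm_of_nat)
  also have "\<dots> = norm (\<Sum>h\<in>Y. Z h)" unfolding eq ..
  also have "\<dots> \<le> (\<Sum>h\<in>Y. norm (Z h))" by (rule norm_sum)
  finally have "(real N ^ card J * norm (S y t))\<^sup>2 \<le> (\<Sum>h\<in>Y. norm (Z h))\<^sup>2"
    by (intro power_mono) auto
  also have "\<dots> \<le> (\<Sum>h\<in>Y. (norm (Z h))\<^sup>2) * real N ^ card J"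
    using sum_squared_le_sum_of_squares[of "\<lambda>h. norm (Z h)" Y] by (simp add: card_Y)
  finally have "real N ^ card J * (real N ^ card J * (norm (S y t))\<^sup>2) \<le> real N ^ card J * (\<Sum>h\<in>Y. (norm (Z h))\<^sup>2)"
    by (simp only: power_mult_distrib power2_eq_square mult_ac)
  then have "real N ^ card J * (norm (S y t))\<^sup>2 \<le> (\<Sum>h\<in>Y. (norm (Z h))\<^sup>2)"
    using N_pos by simp
  then show ?thesis unfolding F using N_pos by (simp add: pos_le_divide_eq mult.commute)
qed

text \<open>
  For \<open>t\<close> of size \<open>2 ^ i\<close>, a frequency \<open>m\<close> is reached only from pins in a box of side \<open>1 / 2 ^ i\<close>.
\<close>

lemma average_over_pins:
  assumes i: "i \<le> n" and t: "2 ^ i \<le> t" "t < 2 * 2 ^ i"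
  shows "(\<Sum>y\<in>Y. \<nu> y * (\<Sum>h\<in>Y. F (int t) (restrict (\<lambda>j. int (h j) - 2 * int t * int (y j)) J)))
    \<le> (\<Prod>j\<in>J. C * (1 / 2 ^ i) powr s j)
       * (\<Sum>m\<in>PiE J (\<lambda>_. {- int (4 * 2 ^ i * N)<..<int (4 * 2 ^ i * N)}). F (int t) m)"
proof -
  let ?B = "PiE J (\<lambda>_. {- int (4 * 2 ^ i * N)<..<int (4 * 2 ^ i * N)})"
  \<comment> \<open>Tests in one coordinate whether \<open>m\<close> belongs to the frequency cube
    of the pin \<open>l\<close>. Exchanging sums then leaves, for each \<open>m\<close>, the mass of
    the pins that reach it.\<close>
  let ?P = "\<lambda>j (m::int) (l::nat). of_bool (0 \<le> m + 2 * int t * int l \<and> m + 2 * int t * int l < int N) :: real"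
  have finB: "finite ?B" using finite_J by (intro finite_PiE) auto
  have box: "(\<Sum>h\<in>Y. F (int t) (restrict (\<lambda>j. int (h j) - 2 * int t * int (y j)) J))
      \<le> (\<Sum>m\<in>?B. F (int t) m * (\<Prod>j\<in>J. ?P j (m j) (y j)))" if y: "y \<in> Y" for y
  proof (rule sum_le_included[where i = "\<lambda>m. restrict (\<lambda>j. nat (m j + 2 * int t * int (y j))) J"])
    show "\<forall>h\<in>Y. \<exists>m\<in>?B. restrict (\<lambda>j. nat (m j + 2 * int t * int (y j))) J = h \<and>
       F (int t) (restrict (\<lambda>j. int (h j) - 2 * int t * int (y j)) J) \<le> F (int t) m * (\<Prod>j\<in>J. ?P j (m j) (y j))"
    proof
      fix h assume h: "h \<in> Y"
      let ?m = "restrict (\<lambda>j. int (h j) - 2 * int t * int (y j)) J"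
      have "?m j \<in> {- int (4 * 2 ^ i * N)<..<int (4 * 2 ^ i * N)}" if j: "j \<in> J" for j
      proof -
        have hj: "h j < N" and yj: "y j < N" using Y_less h y j by auto
        \<comment> \<open>The half side of the frequency box comes from here:
          \<open>t < 2 * 2 ^ i\<close> and \<open>y j < N\<close>, while the offset
          \<open>h j < N\<close> has the opposite sign.\<close>
        have "t * y j \<le> (2 * 2 ^ i) * y j" using t by (intro mult_right_mono) auto
        also have "\<dots> < (2 * 2 ^ i) * N" using yj by simp
        finally have "2 * (t * y j) < 4 * 2 ^ i * N" by linarith
        then have "int (2 * (t * y j)) < int (4 * 2 ^ i * N)" by (simp only: of_nat_less_iff)
        then have "2 * int t * int (y j) < int (4 * 2 ^ i * N)" by (simp add: mult.assoc)
        moreover have "N \<le> 4 * 2 ^ i * N" by simp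
        then have "int (h j) < int (4 * 2 ^ i * N)" using hj by linarith
        moreover have "0 \<le> 2 * int t * int (y j)" by simp
        ultimately have "- int (4 * 2 ^ i * N) < int (h j) - 2 * int t * int (y j)"
          "int (h j) - 2 * int t * int (y j) < int (4 * 2 ^ i * N)"
          by linarith+
        then show ?thesis using j by simp
      qed
      then have "?m \<in> ?B" by auto
      moreover have "restrict (\<lambda>j. nat (?m j + 2 * int t * int (y j))) J = h"
        using h by (intro ext) (auto simp: Y_def PiE_def extensional_def)
      moreover have "(\<Prod>j\<in>J. ?P j (?m j) (y j)) = 1"
        using Y_less[OF h] by (intro prod.neutral) auto
      ultimately show "\<exists>m\<in>?B. restrict (\<lambda>j. nat (m j + 2 * int t * int (y j))) J = h \<and>
         F (int t) (restrict (\<lambda>j. int (h j) - 2 * int t * int (y j)) J) \<le> F (int t) m * (\<Prod>j\<in>J. ?P j (m j) (y j))"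
        by (intro bexI[of _ ?m]) auto
    qed
  qed (use finite_Y finB in \<open>auto simp: F_nonneg prod_nonneg\<close>)
  have mass: "(\<Sum>l<N. p j l * ?P j m l) \<le> C * (1 / 2 ^ i) powr s j" if j: "j \<in> J" for j m
  proof -
    \<comment> \<open>Dividing the test in \<open>?P\<close> by \<open>2 * t * N\<close> puts
      \<open>l / N\<close> into an interval that starts at \<open>b\<close> and has length
      \<open>1 / (2 * t)\<close>, which is at most \<open>1 / 2 ^ i\<close>.\<close>
    define b where "b = - of_int m / (2 * real t * real N)"
    have t0: "0 < real t" using t(1) by (cases t) auto
    have "(\<Sum>l<N. p j l * ?P j m l) \<le> (\<Sum>l | l < 2 ^ n \<and> b \<le> real l / 2 ^ n \<and> real l / 2 ^ n < b + 1 / 2 ^ i. p j l)"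
    proof -
      have "(\<Sum>l<N. p j l * ?P j m l) = (\<Sum>l\<in>{l \<in> {..<N}. 0 \<le> m + 2 * int t * int l \<and> m + 2 * int t * int l < int N}. p j l)"
        unfolding sum.inter_filter[OF finite_lessThan] by (intro sum.cong refl) simp
      also have "\<dots> \<le> (\<Sum>l | l < 2 ^ n \<and> b \<le> real l / 2 ^ n \<and> real l / 2 ^ n < b + 1 / 2 ^ i. p j l)"
      proof (rule sum_mono2)
        show "{l \<in> {..<N}. 0 \<le> m + 2 * int t * int l \<and> m + 2 * int t * int l < int N}
            \<subseteq> {l. l < 2 ^ n \<and> b \<le> real l / 2 ^ n \<and> real l / 2 ^ n < b + 1 / 2 ^ i}"
        proof clarify
          fix l assume l: "l < N" "0 \<le> m + 2 * int t * int l" "m + 2 * int t * int l < int N"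
          have 1: "0 \<le> of_int m + 2 * real t * real l"
          proof -
            have "real_of_int 0 \<le> real_of_int (m + 2 * int t * int l)"
              using l(2) by (simp only: of_int_le_iff)
            then show ?thesis by simp
          qed
          have "real_of_int (m + 2 * int t * int l) < real_of_int (int N)"
            using l(3) by (simp only: of_int_less_iff)
          then have 2: "of_int m + 2 * real t * real l < real N" by simp
          have "b \<le> real l / real N"
            using 1 t0 N_pos by (simp add: b_def field_simps)
          moreover have "real l / real N < b + 1 / (2 * real t)"
            using 2 t0 N_pos by (simp add: b_def field_simps)
          moreover have "1 / (2 * real t) \<le> 1 / 2 ^ i"
          proof (rule divide_left_mono)
            have "2 ^ i \<le> real t" using t(1) by simp
            then show "2 ^ i \<le> 2 * real t" by linarith
          qed (use t0 in auto)
          ultimately show "l < 2 ^ n \<and> b \<le> real l / 2 ^ n \<and> real l / 2 ^ n < b + 1 / 2 ^ i"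
            using l(1) by (simp add: N_def)
        qed
      qed (use j p_nonneg in auto)
      finally show ?thesis .
    qed
    also have "\<dots> \<le> C * (1 / 2 ^ i) powr s j" by (rule p_ball[OF j i])
    finally show ?thesis .
  qed
  have "(\<Sum>y\<in>Y. \<nu> y * (\<Sum>h\<in>Y. F (int t) (restrict (\<lambda>j. int (h j) - 2 * int t * int (y j)) J)))
     \<le> (\<Sum>y\<in>Y. \<nu> y * (\<Sum>m\<in>?B. F (int t) m * (\<Prod>j\<in>J. ?P j (m j) (y j))))"
    by (intro sum_mono mult_left_mono box \<nu>_nonneg)
  also have "\<dots> = (\<Sum>m\<in>?B. F (int t) m * (\<Sum>y\<in>Y. \<Prod>j\<in>J. p j (y j) * ?P j (m j) (y j)))"
  proof -
    have "\<nu> y * (F (int t) m * (\<Prod>j\<in>J. ?P j (m j) (y j))) = F (int t) m * (\<Prod>j\<in>J. p j (y j) * ?P j (m j) (y j))" for y m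
      by (simp only: \<nu>_def prod.distrib mult.left_commute)
    then show ?thesis
      unfolding sum_distrib_left by (simp only:) (rule sum.swap)
  qed
  also have "\<dots> = (\<Sum>m\<in>?B. F (int t) m * (\<Prod>j\<in>J. \<Sum>l<N. p j l * ?P j (m j) l))"
    unfolding Y_def using finite_J by (subst prod_sum_PiE) auto
  also have "\<dots> \<le> (\<Sum>m\<in>?B. F (int t) m * (\<Prod>j\<in>J. C * (1 / 2 ^ i) powr s j))"
    by (intro sum_mono mult_left_mono prod_mono conjI mass F_nonneg sum_nonneg mult_nonneg_nonneg p_nonneg) auto
  finally show ?thesis by (simp add: sum_distrib_left mult_ac)
qed

section \<open>The L2 bound for the lifted weights\<close>

text \<open>With the coordinates in \<open>J\<close> fixed, \<open>G\<close> is a translate of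
  \<open>v\<close>, so the ball condition for \<open>q\<close> handles the last sum first; what
  remains is a product over \<open>J\<close>. This says that the lift loses no dimension: at radius
  r the lifted measure is bounded by a multiple of r to the power \<open>s0\<close> plus the sum of
  the \<open>s j\<close>.\<close>

lemma kernel_sum:
  assumes i: "i \<le> n"
  defines "k \<equiv> \<lambda>x::real. 1 / (1 + (2 ^ i * x)\<^sup>2)"
  shows "(\<Sum>b\<in>X. \<mu> b * (k (G a - G b) * (\<Prod>j\<in>J. k (real (fst a j) / real N - real (fst b j) / real N))))
    \<le> (8 * (C * (1 / 2 ^ i) powr s0)) * (\<Prod>j\<in>J. 8 * (C * (1 / 2 ^ i) powr s j))"
proof -
  let ?x = "\<lambda>j l. real (fst a j) / real N - real l / real N"
  have k0: "0 \<le> k x" for x by (simp add: k_def add_nonneg_nonneg)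
  have last: "(\<Sum>l<N. q l * k (G a - G (z, l))) \<le> 8 * (C * (1 / 2 ^ i) powr s0)" for z
  proof -
    define \<tau> where "\<tau> = G a - (\<Sum>j\<in>J. (real (z j) / real N)\<^sup>2)"
    have \<tau>: "G a - G (z, l) = \<tau> - v l" for l by (simp add: \<tau>_def G_def)
    show ?thesis
      unfolding \<tau> k_def
      by (rule sum_decaying_kernel_le) (use q_ball[OF i] q_nonneg in \<open>auto simp: N_def\<close>)
  qed
  have coord: "(\<Sum>l<N. p j l * k (?x j l)) \<le> 8 * (C * (1 / 2 ^ i) powr s j)" if "j \<in> J" for j
    unfolding k_def
    by (rule sum_decaying_kernel_le) (use p_ball[OF that i] p_nonneg[OF that] in \<open>auto simp: N_def\<close>)
  have "\<mu> (z, l) * (k (G a - G (z, l)) * (\<Prod>j\<in>J. k (?x j (z j))))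
      = (\<Prod>j\<in>J. p j (z j) * k (?x j (z j))) * (q l * k (G a - G (z, l)))" for z l
    by (simp add: \<mu>_def \<nu>_def prod.distrib)
  then have "(\<Sum>b\<in>X. \<mu> b * (k (G a - G b) * (\<Prod>j\<in>J. k (?x j (fst b j)))))
     = (\<Sum>z\<in>Y. (\<Prod>j\<in>J. p j (z j) * k (?x j (z j))) * (\<Sum>l<N. q l * k (G a - G (z, l))))"
    by (simp only: X_def sum.cartesian_product' fst_conv sum_distrib_left)
  also have "\<dots> \<le> (\<Sum>z\<in>Y. (\<Prod>j\<in>J. p j (z j) * k (?x j (z j))) * (8 * (C * (1 / 2 ^ i) powr s0)))"
    by (intro sum_mono mult_left_mono last prod_nonneg mult_nonneg_nonneg p_nonneg k0)
  also have "\<dots> = (8 * (C * (1 / 2 ^ i) powr s0)) * (\<Prod>j\<in>J. \<Sum>l<N. p j l * k (?x j l))"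
    unfolding Y_def using finite_J by (subst prod_sum_PiE) (simp_all only: sum_distrib_left mult.commute finite_lessThan)
  also have "\<dots> \<le> (8 * (C * (1 / 2 ^ i) powr s0)) * (\<Prod>j\<in>J. 8 * (C * (1 / 2 ^ i) powr s j))"
    using C_ge_1 by (intro mult_left_mono prod_mono conjI coord sum_nonneg mult_nonneg_nonneg p_nonneg k0) auto
  finally show ?thesis .
qed

text \<open>1088 = 17 * 8^2, with 17 from \<open>dirichlet_bound\<close> and 8 from the kernel
  length \<open>2 * (4 * 2 ^ i * N)\<close>; comparing phases with unscaled differences costs
  \<open>1 / c\<^sup>2\<close>. For \<open>G\<close> the length factor is 4 and 17 * 4^2 = 272 would
  do.\<close>

definition B :: real where "B = 1088 / c\<^sup>2"
text \<open>Per coordinate in \<open>J\<close>: 4 from using \<open>norm_w_le\<close> twice and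
  \<open>C\<close> from averaging over pins. Per coordinate of the lift: 8 and \<open>C\<close> from
  \<open>kernel_sum\<close>, and \<open>B\<close>. Given \<open>J\<close> and \<open>C\<close>,
  nothing here depends on \<open>n\<close>.\<close>

definition A :: real where "A = (4 * C) ^ card J * (8 * B * C) ^ Suc (card J)"

lemma B_pos: "0 < B" using c_pos by (simp add: B_def)
lemma A_nonneg: "0 \<le> A" using B_pos C_ge_1 by (simp add: A_def)

lemma dirichlet_G_bound:
  assumes a: "a \<in> X" and b: "b \<in> X"
  shows "(norm (dirichlet (2 * (2 * 2 ^ i)) (c * G a - c * G b)))\<^sup>2
    \<le> B * (2 ^ i)\<^sup>2 * (1 / (1 + (2 ^ i * (G a - G b))\<^sup>2))"
proof -
  let ?\<theta> = "c * G a - c * G b"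
  have \<theta>: "\<bar>?\<theta>\<bar> = c * \<bar>G a - G b\<bar>" using c_pos by (simp add: right_diff_distrib[symmetric] abs_mult)
  also have "\<dots> \<le> c * (real (card J) + 1)"
    using G_bounds[OF a] G_bounds[OF b] c_pos by (intro mult_left_mono) auto
  also have "\<dots> = 1" by (simp add: c_def)
  finally have "\<bar>?\<theta>\<bar> \<le> 1" .
  then have "(norm (dirichlet (2 * (2 * 2 ^ i)) ?\<theta>))\<^sup>2 \<le> 17 * (real (2 * (2 * 2 ^ i)))\<^sup>2 / (1 + (real (2 * (2 * 2 ^ i)) * ?\<theta>)\<^sup>2)"
    by (rule dirichlet_bound)
  also have "\<dots> = 17 * (4 * 2 ^ i)\<^sup>2 * (1 / (1 + (4 * 2 ^ i * ?\<theta>)\<^sup>2))" by simp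
  also have "\<dots> \<le> 17 * (4 * 2 ^ i)\<^sup>2 * ((1 / c\<^sup>2) * (1 / (1 + (2 ^ i * (G a - G b))\<^sup>2)))"
  proof (intro mult_left_mono inverse_one_plus_square_scale c_pos c_le_1)
    show "c * \<bar>2 ^ i * (G a - G b)\<bar> \<le> \<bar>4 * 2 ^ i * ?\<theta>\<bar>"
      using c_pos by (simp add: abs_mult \<theta>)
  qed auto
  also have "\<dots> = 272 / c\<^sup>2 * (2 ^ i)\<^sup>2 * (1 / (1 + (2 ^ i * (G a - G b))\<^sup>2))"
    by (simp add: power_mult_distrib)
  also have "\<dots> \<le> B * (2 ^ i)\<^sup>2 * (1 / (1 + (2 ^ i * (G a - G b))\<^sup>2))"
    unfolding B_def using c_pos by (intro mult_right_mono divide_right_mono) (auto simp: add_nonneg_nonneg)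
  finally show ?thesis .
qed

lemma dirichlet_u_bound:
  assumes a: "a \<in> X" and b: "b \<in> X" and j: "j \<in> J"
  shows "(norm (dirichlet (2 * (4 * 2 ^ i * N)) (u j a - u j b)))\<^sup>2
    \<le> B * (2 ^ i * real N)\<^sup>2 * (1 / (1 + (2 ^ i * (real (fst a j) / real N - real (fst b j) / real N))\<^sup>2))"
proof -
  let ?\<theta> = "u j a - u j b"
  let ?d = "real (fst a j) / real N - real (fst b j) / real N"
  have \<theta>: "real N * ?\<theta> = c * ?d" using N_pos by (simp add: u_def field_simps power2_eq_square)
  have ab: "fst a j < N" "fst b j < N" using a b j by (auto simp: X_def Y_def)
  have "\<bar>?d\<bar> \<le> 1"
  proof -
    have "0 \<le> real (fst a j) / real N" "real (fst a j) / real N \<le> 1" "0 \<le> real (fst b j) / real N" "real (fst b j) / real N \<le> 1"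
      using ab by auto
    then show ?thesis by linarith
  qed
  then have "c * \<bar>?d\<bar> \<le> 1 * 1" using c_pos c_le_1 by (intro mult_mono) auto
  then have "\<bar>real N * ?\<theta>\<bar> \<le> 1" unfolding \<theta> using c_pos by (simp add: abs_mult)
  then have "real N * \<bar>?\<theta>\<bar> \<le> 1" by (simp add: abs_mult)
  moreover have "1 * \<bar>?\<theta>\<bar> \<le> real N * \<bar>?\<theta>\<bar>" using N_pos by (intro mult_right_mono) auto
  ultimately have "\<bar>?\<theta>\<bar> \<le> 1" by (metis mult_1 order_trans)
  then have "(norm (dirichlet (2 * (4 * 2 ^ i * N)) ?\<theta>))\<^sup>2
     \<le> 17 * (real (2 * (4 * 2 ^ i * N)))\<^sup>2 / (1 + (real (2 * (4 * 2 ^ i * N)) * ?\<theta>)\<^sup>2)"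
    by (rule dirichlet_bound)
  also have "\<dots> = 17 * (8 * (2 ^ i * real N))\<^sup>2 * (1 / (1 + (8 * 2 ^ i * (real N * ?\<theta>))\<^sup>2))" by (simp add: mult.assoc)
  also have "\<dots> \<le> 17 * (8 * (2 ^ i * real N))\<^sup>2 * ((1 / c\<^sup>2) * (1 / (1 + (2 ^ i * ?d)\<^sup>2)))"
  proof (intro mult_left_mono inverse_one_plus_square_scale c_pos c_le_1)
    show "c * \<bar>2 ^ i * ?d\<bar> \<le> \<bar>8 * 2 ^ i * (real N * ?\<theta>)\<bar>"
      unfolding \<theta> using c_pos by (simp add: abs_mult)
  qed auto
  also have "\<dots> = B * (2 ^ i * real N)\<^sup>2 * (1 / (1 + (2 ^ i * ?d)\<^sup>2))"
    by (simp add: B_def power_mult_distrib)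
  finally show ?thesis .
qed

text \<open>The large sieve turns the box into kernels of width 1/R, R = 2^i, at pairs of points,
  and \<open>kernel_sum\<close> bounds their mass. The factor
  \<open>2 ^ i * (2 ^ i * real N) ^ card J\<close> is the number of frequencies in the box up to a
  constant: it enters squared through \<open>L\<close> and is divided off once on the left.\<close>

lemma box_bound:
  assumes i: "i \<le> n"
  shows "(\<Sum>\<tau>\<in>{- int (2 * 2 ^ i)<..<int (2 * 2 ^ i)}. \<Sum>m\<in>PiE J (\<lambda>_. {- int (4 * 2 ^ i * N)<..<int (4 * 2 ^ i * N)}). F \<tau> m)
    \<le> 4 ^ card J * B ^ Suc (card J) * 2 ^ i * (2 ^ i * real N) ^ card J
       * ((8 * (C * (1 / 2 ^ i) powr s0)) * (\<Prod>j\<in>J. 8 * (C * (1 / 2 ^ i) powr s j)))"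
    (is "?Q \<le> ?rhs")
proof -
  let ?k = "\<lambda>x::real. 1 / (1 + (2 ^ i * x)\<^sup>2)"
  let ?x = "\<lambda>a b j. real (fst a j) / real N - real (fst b j) / real N"
  let ?M = "(8 * (C * (1 / 2 ^ i) powr s0)) * (\<Prod>j\<in>J. 8 * (C * (1 / 2 ^ i) powr s j))"
  define L where "L = B * (2 ^ i)\<^sup>2 * (B * (2 ^ i * real N)\<^sup>2) ^ card J"
  have L0: "0 \<le> L" using B_pos by (simp add: L_def)
  have k0: "0 \<le> ?k x" for x by (simp add: add_nonneg_nonneg)
  have D: "(norm (dirichlet (2 * (2 * 2 ^ i)) (c * G a - c * G b)))\<^sup>2 * (\<Prod>j\<in>J. (norm (dirichlet (2 * (4 * 2 ^ i * N)) (u j a - u j b)))\<^sup>2)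
      \<le> L * (?k (G a - G b) * (\<Prod>j\<in>J. ?k (?x a b j)))" if ab: "a \<in> X" "b \<in> X" for a b
  proof -
    have "(norm (dirichlet (2 * (2 * 2 ^ i)) (c * G a - c * G b)))\<^sup>2 * (\<Prod>j\<in>J. (norm (dirichlet (2 * (4 * 2 ^ i * N)) (u j a - u j b)))\<^sup>2)
      \<le> (B * (2 ^ i)\<^sup>2 * ?k (G a - G b)) * (\<Prod>j\<in>J. B * (2 ^ i * real N)\<^sup>2 * ?k (?x a b j))"
      using B_pos
      by (intro mult_mono prod_mono conjI dirichlet_G_bound dirichlet_u_bound ab prod_nonneg mult_nonneg_nonneg k0) auto
    also have "\<dots> = L * (?k (G a - G b) * (\<Prod>j\<in>J. ?k (?x a b j)))"
    proof -
      have "(\<Prod>j\<in>J. B * (2 ^ i * real N)\<^sup>2 * ?k (?x a b j)) = (B * (2 ^ i * real N)\<^sup>2) ^ card J * (\<Prod>j\<in>J. ?k (?x a b j))"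
        by (simp only: prod.distrib[of "\<lambda>_. B * (2 ^ i * real N)\<^sup>2"] prod_constant)
      then show ?thesis by (simp only: L_def mult_ac)
    qed
    finally show ?thesis .
  qed
  have Q0: "0 \<le> ?Q" by (intro sum_nonneg F_nonneg)
  have "2 ^ i * (2 ^ i * real N) ^ card J * ?Q \<le> real (2 * 2 ^ i) * real (4 * 2 ^ i * N) ^ card J * ?Q"
    using Q0 by (intro mult_right_mono mult_mono power_mono) auto
  also have "\<dots> \<le> (\<Sum>a\<in>X. \<Sum>b\<in>X. norm (w a) * norm (w b) *
         ((norm (dirichlet (2 * (2 * 2 ^ i)) (c * G a - c * G b)))\<^sup>2 * (\<Prod>j\<in>J. (norm (dirichlet (2 * (4 * 2 ^ i * N)) (u j a - u j b)))\<^sup>2)))"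
    unfolding F_def using finite_J by (rule exponential_sum_box_bound)
  also have "\<dots> \<le> (\<Sum>a\<in>X. \<Sum>b\<in>X. (2 ^ card J * \<mu> a) * (2 ^ card J * \<mu> b) * (L * (?k (G a - G b) * (\<Prod>j\<in>J. ?k (?x a b j)))))"
    by (intro sum_mono mult_mono D norm_w_le) (auto simp: \<mu>_nonneg prod_nonneg)
  also have "\<dots> = 2 ^ card J * 2 ^ card J * L * (\<Sum>a\<in>X. \<mu> a * (\<Sum>b\<in>X. \<mu> b * (?k (G a - G b) * (\<Prod>j\<in>J. ?k (?x a b j)))))"
    by (simp only: sum_distrib_left mult_ac)
  also have "\<dots> \<le> 2 ^ card J * 2 ^ card J * L * (\<Sum>a\<in>X. \<mu> a * ?M)"
    using L0 by (intro mult_left_mono sum_mono kernel_sum i \<mu>_nonneg) auto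
  also have "\<dots> = 4 ^ card J * L * ?M"
    by (simp add: sum_distrib_right[symmetric] \<mu>_sum power_mult_distrib[symmetric] del: sum_distrib_right)
  also have "\<dots> = 2 ^ i * (2 ^ i * real N) ^ card J * ?rhs"
  proof -
    have "L = B ^ Suc (card J) * (2 ^ i * 2 ^ i) * ((2 ^ i * real N) ^ card J * (2 ^ i * real N) ^ card J)"
      by (simp only: L_def power2_eq_square power_mult_distrib power_Suc mult_ac)
    then show ?thesis by (simp only: mult_ac)
  qed
  finally show ?thesis using N_pos by simp
qed

text \<open>The pins contribute R^(-\<beta>), the number of frequencies R^d and the kernels
  R^(-\<alpha>), where R = 2^i. The density \<open>real N ^ card J\<close> of lattice frequencies in
  a unit cube cancels against the mean in \<open>local_constancy\<close>.\<close>

lemma scale_bound: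
  assumes i: "i \<le> n"
  shows "(\<Sum>t\<in>{2 ^ i..<2 * 2 ^ i}. \<Sum>y\<in>Y. \<nu> y * (norm (S y t))\<^sup>2)
    \<le> A * ((1 / 2) powr (s0 + 2 * (\<Sum>j\<in>J. s j) - (real (card J) + 1))) ^ i"
proof -
  let ?B = "PiE J (\<lambda>_. {- int (4 * 2 ^ i * N)<..<int (4 * 2 ^ i * N)})"
  let ?P = "\<Prod>j\<in>J. C * (1 / 2 ^ i) powr s j"
  let ?r = "\<Prod>j\<in>J. (1 / 2 ^ i) powr s j"
  have P0: "0 \<le> ?P" using C_ge_1 by (intro prod_nonneg) auto
  have r: "?r = (1 / 2 ^ i) powr (\<Sum>j\<in>J. s j)" by (simp add: powr_sum)
  have "(\<Sum>t\<in>{2 ^ i..<2 * 2 ^ i}. \<Sum>y\<in>Y. \<nu> y * (norm (S y t))\<^sup>2)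
     \<le> (\<Sum>t\<in>{2 ^ i..<2 * 2 ^ i}. \<Sum>y\<in>Y. \<nu> y * ((\<Sum>h\<in>Y. F (int t) (restrict (\<lambda>j. int (h j) - 2 * int t * int (y j)) J)) / real N ^ card J))"
    by (intro sum_mono mult_left_mono local_constancy \<nu>_nonneg)
  also have "\<dots> = (\<Sum>t\<in>{2 ^ i..<2 * 2 ^ i}. \<Sum>y\<in>Y. \<nu> y * (\<Sum>h\<in>Y. F (int t) (restrict (\<lambda>j. int (h j) - 2 * int t * int (y j)) J))) / real N ^ card J"
    by (simp only: sum_divide_distrib[symmetric] times_divide_eq_right)
  also have "\<dots> \<le> (\<Sum>t\<in>{2 ^ i..<2 * 2 ^ i}. ?P * (\<Sum>m\<in>?B. F (int t) m)) / real N ^ card J"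
    by (intro divide_right_mono sum_mono average_over_pins i) auto
  also have "\<dots> = ?P * (\<Sum>t\<in>{2 ^ i..<2 * 2 ^ i}. \<Sum>m\<in>?B. F (int t) m) / real N ^ card J"
    by (simp only: sum_distrib_left)
  also have "(\<Sum>t\<in>{2 ^ i..<2 * 2 ^ i}. \<Sum>m\<in>?B. F (int t) m)
     \<le> (\<Sum>\<tau>\<in>{- int (2 * 2 ^ i)<..<int (2 * 2 ^ i)}. \<Sum>m\<in>?B. F \<tau> m)"
  proof (rule sum_le_included[where i = nat])
    show "\<forall>t\<in>{2 ^ i..<2 * 2 ^ i}. \<exists>\<tau>\<in>{- int (2 * 2 ^ i)<..<int (2 * 2 ^ i)}. nat \<tau> = t \<and> (\<Sum>m\<in>?B. F (int t) m) \<le> (\<Sum>m\<in>?B. F \<tau> m)"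
    proof
      fix t :: nat assume "t \<in> {2 ^ i..<2 * 2 ^ i}"
      then have "int t < int (2 * 2 ^ i)" by (simp only: of_nat_less_iff atLeastLessThan_iff)
      then show "\<exists>\<tau>\<in>{- int (2 * 2 ^ i)<..<int (2 * 2 ^ i)}. nat \<tau> = t \<and> (\<Sum>m\<in>?B. F (int t) m) \<le> (\<Sum>m\<in>?B. F \<tau> m)"
        by (intro bexI[of _ "int t"]) auto
    qed
  qed (auto intro!: sum_nonneg F_nonneg)
  also have "\<dots> \<le> 4 ^ card J * B ^ Suc (card J) * 2 ^ i * (2 ^ i * real N) ^ card J
       * ((8 * (C * (1 / 2 ^ i) powr s0)) * (\<Prod>j\<in>J. 8 * (C * (1 / 2 ^ i) powr s j)))"
    by (rule box_bound[OF i])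
  also have "?P * \<dots> / real N ^ card J
     = A * (2 ^ i * (2 ^ i) ^ card J * ((1 / 2 ^ i) powr s0 * (?r * ?r)))"
    using N_pos by (simp add: A_def prod.distrib power_mult_distrib)
  also have "2 ^ i * (2 ^ i) ^ card J * ((1 / 2 ^ i) powr s0 * (?r * ?r))
     = ((1 / 2) powr (s0 + 2 * (\<Sum>j\<in>J. s j) - (real (card J) + 1))) ^ i"
  proof -
    have e: "(1 / 2 ^ i) powr a = ((1/2::real) powr a) ^ i" for a
    proof -
      have "1 / 2 ^ i = (1 / 2 :: real) powr real i" by (simp add: powr_realpow power_one_over)
      moreover have "((1 / 2 :: real) powr a) ^ i = ((1 / 2) powr a) powr real i" by (simp add: powr_realpow)
      ultimately show ?thesis by (simp only: powr_powr mult.commute)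
    qed
    have "2 ^ i * (2 ^ i) ^ card J = ((1/2::real) powr - (real (card J) + 1)) ^ i"
    proof -
      have "(1 / 2 ^ i :: real) powr - (real (card J) + 1) = (2 ^ i) powr real (Suc (card J))"
      proof -
        have "(1 / 2 ^ i :: real) powr - x = (2 ^ i) powr x" for x
          by (simp add: powr_minus powr_divide)
        then show ?thesis by (simp only: of_nat_Suc add.commute)
      qed
      also have "\<dots> = 2 ^ i * (2 ^ i) ^ card J" by (subst powr_realpow) auto
      finally show ?thesis unfolding e by simp
    qed
    moreover have "- (real (card J) + 1) + (s0 + ((\<Sum>j\<in>J. s j) + (\<Sum>j\<in>J. s j))) = s0 + 2 * (\<Sum>j\<in>J. s j) - (real (card J) + 1)"
      by simp
    ultimately show ?thesis
      unfolding r by (simp only: e power_mult_distrib[symmetric] powr_add[symmetric])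
  qed
  finally show ?thesis using P0 by (simp add: mult_left_mono divide_right_mono)
qed

section \<open>From frequencies to many distances\<close>

text \<open>Closeness of two values is dominated by 4/N^2 times a squared Dirichlet kernel, and
  duality turns that into a sum of |S|^2 over differences of times, at most 2N for each time; so
  8/N. Time 0 contributes 1 and the dyadic blocks a geometric series.\<close>

lemma energy_bound:
  assumes \<eta>: "0 < s0 + 2 * (\<Sum>j\<in>J. s j) - (real (card J) + 1)" (is "0 < ?\<eta>")
  shows "(\<Sum>y\<in>Y. \<nu> y * (\<Sum>a\<in>X. \<Sum>b\<in>X. \<mu> a * \<mu> b * of_bool (\<bar>f y a - f y b\<bar> \<le> 1 / real N)))
    \<le> 8 * (1 + A / (1 - (1 / 2) powr ?\<eta>)) / real N"
proof -
  have one: "(\<Sum>a\<in>X. \<Sum>b\<in>X. \<mu> a * \<mu> b * of_bool (\<bar>f y a - f y b\<bar> \<le> 1 / real N)) \<le> 8 / real N * (\<Sum>t<N. (norm (S y t))\<^sup>2)" for y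
  proof -
    let ?D = "\<lambda>a b. (norm (dirichlet N (c * f y a - c * f y b)))\<^sup>2"
    \<comment> \<open>The square roots serve both sides of the duality: paired at two points they
      give \<open>\<mu> a * \<mu> b\<close> after squaring, and paired at two times they give
      \<open>\<mu> a\<close> itself.\<close>
    define e where "e t a = complex_of_real (sqrt (\<mu> a)) * cis (real t * (c * f y a))" for t a
    have ee: "e t a * cnj (e t' b) = of_real (sqrt (\<mu> a) * sqrt (\<mu> b)) * cis (real t * (c * f y a) - real t' * (c * f y b))"
      for t t' a b
    proof -
      have "cis (real t * (c * f y a)) * cis (- (real t' * (c * f y b))) = cis (real t * (c * f y a) - real t' * (c * f y b))"
        by (simp add: cis_mult)
      moreover have "e t a * cnj (e t' b) = of_real (sqrt (\<mu> a) * sqrt (\<mu> b)) * (cis (real t * (c * f y a)) * cis (- (real t' * (c * f y b))))"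
        by (simp add: e_def cis_cnj)
      ultimately show ?thesis by simp
    qed
    have "of_bool (\<bar>f y a - f y b\<bar> \<le> 1 / real N) \<le> 4 / (real N)\<^sup>2 * ?D a b" for a b
    proof (cases "\<bar>f y a - f y b\<bar> \<le> 1 / real N")
      case True
      have "real N * \<bar>c * f y a - c * f y b\<bar> = c * (real N * \<bar>f y a - f y b\<bar>)"
        using c_pos by (simp add: right_diff_distrib[symmetric] abs_mult)
      also have "\<dots> \<le> 1 * 1"
        using True c_pos c_le_1 N_pos by (intro mult_mono) (auto simp: field_simps)
      finally have "real N / 2 \<le> norm (dirichlet N (c * f y a - c * f y b))"
        by (intro dirichlet_lower) simp
      then have "(real N / 2)\<^sup>2 \<le> ?D a b" by (intro power_mono) auto
      then show ?thesis using True N_pos by (simp add: field_simps power2_eq_square)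
    qed simp
    then have "(\<Sum>a\<in>X. \<Sum>b\<in>X. \<mu> a * \<mu> b * of_bool (\<bar>f y a - f y b\<bar> \<le> 1 / real N))
        \<le> (\<Sum>a\<in>X. \<Sum>b\<in>X. \<mu> a * \<mu> b * (4 / (real N)\<^sup>2 * ?D a b))"
      by (intro sum_mono mult_left_mono mult_nonneg_nonneg \<mu>_nonneg)
    also have "\<dots> = 4 / (real N)\<^sup>2 * (\<Sum>a\<in>X. \<Sum>b\<in>X. \<mu> a * \<mu> b * ?D a b)"
      by (simp only: sum_distrib_left mult_ac)
    also have "(\<Sum>a\<in>X. \<Sum>b\<in>X. \<mu> a * \<mu> b * ?D a b) = (\<Sum>(a, b)\<in>X \<times> X. (norm (\<Sum>t<N. 1 * (e t a * cnj (e t b))))\<^sup>2)"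
    proof -
      have "(\<Sum>t<N. 1 * (e t a * cnj (e t b))) = of_real (sqrt (\<mu> a) * sqrt (\<mu> b)) * dirichlet N (c * f y a - c * f y b)" for a b
        unfolding dirichlet_def sum_distrib_left mult_1 ee by (simp only: right_diff_distrib)
      then show ?thesis
        by (simp add: sum.cartesian_product[symmetric] norm_mult power_mult_distrib \<mu>_nonneg)
    qed
    also have "\<dots> \<le> (\<Sum>t<N. \<Sum>t'<N. norm (1::complex) * norm (1::complex) * (norm (\<Sum>a\<in>X. e t a * cnj (e t' a)))\<^sup>2)"
      by (rule double_large_sieve)
    also have "\<dots> = (\<Sum>t<N. \<Sum>t'<N. (norm (S y (nat \<bar>int t - int t'\<bar>)))\<^sup>2)"
    proof (intro sum.cong refl)
      fix t t'
      have ee': "e t a * cnj (e t' a) = of_real (\<mu> a) * cis ((real t - real t') * (c * f y a))" for a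
        using \<mu>_nonneg[of a] unfolding ee by (simp only: left_diff_distrib real_sqrt_mult_self abs_of_nonneg)
      show "norm (1::complex) * norm (1::complex) * (norm (\<Sum>a\<in>X. e t a * cnj (e t' a)))\<^sup>2 = (norm (S y (nat \<bar>int t - int t'\<bar>)))\<^sup>2"
      proof (cases "t' \<le> t")
        case True
        then have "real (nat \<bar>int t - int t'\<bar>) = real t - real t'" by simp
        then show ?thesis by (simp add: ee' S_def)
      next
        case False
        then have *: "real (nat \<bar>int t - int t'\<bar>) = - (real t - real t')" by simp
        have "S y (nat \<bar>int t - int t'\<bar>) = cnj (\<Sum>a\<in>X. e t a * cnj (e t' a))"
          unfolding S_def ee' * mult_minus_left by (simp add: cis_cnj del: minus_diff_eq)
        then show ?thesis by (simp only: complex_mod_cnj norm_one mult_1)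
      qed
    qed
    also have "\<dots> \<le> 2 * real N * (\<Sum>t<N. (norm (S y t))\<^sup>2)"
      by (rule sum_nat_distance_le) auto
    finally show ?thesis using N_pos by (simp add: mult_left_mono power2_eq_square divide_right_mono field_simps)
  qed
  define \<rho> where "\<rho> = (1 / 2 :: real) powr ?\<eta>"
  have \<rho>: "0 < \<rho>" "\<rho> < 1" using powr_less_mono2[OF \<eta>, of "1 / 2" 1] by (simp_all add: \<rho>_def)
  have "(\<Sum>y\<in>Y. \<nu> y * (\<Sum>a\<in>X. \<Sum>b\<in>X. \<mu> a * \<mu> b * of_bool (\<bar>f y a - f y b\<bar> \<le> 1 / real N)))
      \<le> (\<Sum>y\<in>Y. \<nu> y * (8 / real N * (\<Sum>t<N. (norm (S y t))\<^sup>2)))"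
    by (intro sum_mono mult_left_mono one \<nu>_nonneg)
  also have "\<dots> = 8 / real N * (\<Sum>t<N. \<Sum>y\<in>Y. \<nu> y * (norm (S y t))\<^sup>2)"
    unfolding sum_distrib_left by (subst sum.swap) (simp only: mult_ac)
  also have "(\<Sum>t<N. \<Sum>y\<in>Y. \<nu> y * (norm (S y t))\<^sup>2) = (\<Sum>y\<in>Y. \<nu> y * (norm (S y 0))\<^sup>2) + (\<Sum>t\<in>{1..<2 ^ n}. \<Sum>y\<in>Y. \<nu> y * (norm (S y t))\<^sup>2)"
  proof -
    have "{..<N} = insert 0 {1..<2 ^ n}" using N_pos by (auto simp: N_def)
    then show ?thesis by simp
  qed
  also have "(\<Sum>y\<in>Y. \<nu> y * (norm (S y 0))\<^sup>2) = 1"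
  proof -
    have "S y 0 = 1" for y by (simp add: S_def \<mu>_sum flip: of_real_sum)
    then show ?thesis by (simp add: \<nu>_sum)
  qed
  also have "(\<Sum>t\<in>{1..<2 ^ n}. \<Sum>y\<in>Y. \<nu> y * (norm (S y t))\<^sup>2) \<le> (\<Sum>i<n. A * \<rho> ^ i)"
    unfolding sum_dyadic_blocks \<rho>_def by (intro sum_mono scale_bound) auto
  also have "\<dots> \<le> A * (1 / (1 - \<rho>))"
  proof -
    have "(\<Sum>i<n. \<rho> ^ i) = (1 - \<rho> ^ n) / (1 - \<rho>)" using \<rho> by (simp add: sum_gp_strict)
    also have "\<dots> \<le> 1 / (1 - \<rho>)" using \<rho> by (intro divide_right_mono) auto
    finally show ?thesis unfolding sum_distrib_left[symmetric] by (intro mult_left_mono A_nonneg)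
  qed
  finally show ?thesis using N_pos by (simp add: \<rho>_def mult_left_mono divide_right_mono)
qed

text \<open>Averaging finds a pin of small energy, and Cauchy-Schwarz then prevents the mass 1 from
  sitting in few cells. Zero weights are excluded on both sides because in the application only
  positive weight guarantees nearness to the given sets.\<close>

lemma many_bins:
  assumes \<eta>: "0 < s0 + 2 * (\<Sum>j\<in>J. s j) - (real (card J) + 1)"
  defines "K \<equiv> 8 * (1 + A / (1 - (1 / 2) powr (s0 + 2 * (\<Sum>j\<in>J. s j) - (real (card J) + 1))))"
  shows "\<exists>y\<in>Y. 0 < \<nu> y \<and> real N \<le> K * real (card ((\<lambda>a. \<lfloor>real N * f y a\<rfloor>) ` {a \<in> X. 0 < \<mu> a}))"
proof -
  define E where "E y = (\<Sum>a\<in>X. \<Sum>b\<in>X. \<mu> a * \<mu> b * of_bool (\<bar>f y a - f y b\<bar> \<le> 1 / real N))" for y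
  have "\<exists>y\<in>Y. 0 < \<nu> y \<and> E y \<le> K / real N"
  proof (rule ccontr)
    assume neg: "\<not> ?thesis"
    obtain y0 where y0: "y0 \<in> Y" "0 < \<nu> y0"
      using \<nu>_sum sum_nonpos[of Y \<nu>] by (metis not_less not_one_le_zero)
    \<comment> \<open>Pins of weight zero give equality; the pin \<open>y0\<close> makes the
      inequality strict.\<close>
    have "(\<Sum>y\<in>Y. \<nu> y * (K / real N)) < (\<Sum>y\<in>Y. \<nu> y * E y)"
    proof (rule sum_strict_mono_ex1[OF finite_Y])
      show "\<forall>y\<in>Y. \<nu> y * (K / real N) \<le> \<nu> y * E y"
      proof
        fix y assume y: "y \<in> Y"
        show "\<nu> y * (K / real N) \<le> \<nu> y * E y"
        proof (cases "0 < \<nu> y")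
          case True
          then show ?thesis using neg y by (intro mult_left_mono) auto
        next
          case False
          then have "\<nu> y = 0" using \<nu>_nonneg[of y] by simp
          then show ?thesis by simp
        qed
      qed
      show "\<exists>y\<in>Y. \<nu> y * (K / real N) < \<nu> y * E y"
        using neg y0 by (intro bexI[of _ y0] mult_strict_left_mono) auto
    qed
    moreover have "(\<Sum>y\<in>Y. \<nu> y * (K / real N)) = K / real N"
      by (simp only: sum_distrib_right[symmetric] \<nu>_sum mult_1)
    ultimately show False
      using energy_bound[OF \<eta>] unfolding E_def K_def by linarith
  qed
  then obtain y where y: "y \<in> Y" "0 < \<nu> y" and E: "E y \<le> K / real N" by blast
  define g where "g a = \<lfloor>real N * f y a\<rfloor>" for a
  define X' where "X' = {a \<in> X. 0 < \<mu> a}"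
  define bin where "bin b = (\<Sum>a | a \<in> X' \<and> g a = b. \<mu> a)" for b
  have finX': "finite X'" using finite_X by (simp add: X'_def)
  have X'sum: "(\<Sum>a\<in>X'. \<mu> a) = 1"
  proof -
    have "(\<Sum>a\<in>X. \<mu> a) = (\<Sum>a\<in>X'. \<mu> a)"
      using \<mu>_nonneg by (intro sum.mono_neutral_right) (auto simp: X'_def finite_X less_le)
    then show ?thesis by (simp add: \<mu>_sum)
  qed
  have "(\<Sum>b\<in>g ` X'. bin b) = 1"
    unfolding bin_def X'sum[symmetric] by (rule sum.group) (use finX' in auto)
  then have "1 \<le> (\<Sum>b\<in>g ` X'. (bin b)\<^sup>2) * real (card (g ` X'))"
    using sum_squared_le_sum_of_squares[of bin "g ` X'"] by simp
  also have "(\<Sum>b\<in>g ` X'. (bin b)\<^sup>2) \<le> E y"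
  proof -
    have "(\<Sum>b\<in>g ` X'. (bin b)\<^sup>2) = (\<Sum>b\<in>g ` X'. \<Sum>a | a \<in> X' \<and> g a = b. \<mu> a * bin (g a))"
    proof (rule sum.cong[OF refl])
      fix b
      have "(bin b)\<^sup>2 = (\<Sum>a | a \<in> X' \<and> g a = b. \<mu> a * bin b)"
        by (simp add: power2_eq_square bin_def flip: sum_distrib_right)
      then show "(bin b)\<^sup>2 = (\<Sum>a | a \<in> X' \<and> g a = b. \<mu> a * bin (g a))" by simp
    qed
    also have "\<dots> = (\<Sum>a\<in>X'. \<mu> a * bin (g a))"
      by (rule sum.group) (use finX' in auto)
    also have "\<dots> \<le> (\<Sum>a\<in>X'. \<mu> a * (\<Sum>b\<in>X. \<mu> b * of_bool (\<bar>f y a - f y b\<bar> \<le> 1 / real N)))"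
    proof (intro sum_mono mult_left_mono \<mu>_nonneg)
      fix a
      have "bin (g a) \<le> (\<Sum>b | b \<in> X' \<and> g b = g a. \<mu> b * of_bool (\<bar>f y a - f y b\<bar> \<le> 1 / real N))"
        unfolding bin_def
      proof (rule sum_mono)
        fix b assume "b \<in> {b. b \<in> X' \<and> g b = g a}"
        then have "\<lfloor>real N * f y a\<rfloor> = \<lfloor>real N * f y b\<rfloor>" by (simp add: g_def)
        then have "\<bar>real N * f y a - real N * f y b\<bar> \<le> 1" by linarith
        then have "real N * \<bar>f y a - f y b\<bar> \<le> 1" by (simp add: abs_mult flip: right_diff_distrib)
        then have "\<bar>f y a - f y b\<bar> \<le> 1 / real N" using N_pos by (simp add: field_simps)
        then show "\<mu> b \<le> \<mu> b * of_bool (\<bar>f y a - f y b\<bar> \<le> 1 / real N)" by simp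
      qed
      also have "\<dots> \<le> (\<Sum>b\<in>X. \<mu> b * of_bool (\<bar>f y a - f y b\<bar> \<le> 1 / real N))"
        using \<mu>_nonneg by (intro sum_mono2) (auto simp: finite_X X'_def)
      finally show "bin (g a) \<le> \<dots>" .
    qed
    also have "\<dots> \<le> (\<Sum>a\<in>X. \<mu> a * (\<Sum>b\<in>X. \<mu> b * of_bool (\<bar>f y a - f y b\<bar> \<le> 1 / real N)))"
      using \<mu>_nonneg by (intro sum_mono2) (auto simp: finite_X X'_def intro!: mult_nonneg_nonneg sum_nonneg)
    also have "\<dots> = E y" by (simp add: E_def sum_distrib_left mult.assoc)
    finally show ?thesis .
  qed
  also have "E y \<le> K / real N" by (rule E)
  finally have "1 \<le> K / real N * real (card (g ` X'))" by (simp add: mult_right_mono)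
  then have "real N \<le> K * real (card (g ` X'))" using N_pos by (simp add: field_simps)
  then show ?thesis using y unfolding g_def X'_def by blast
qed

end

section \<open>Frostman weights on the grid\<close>

text \<open>Levels count upwards from single cells, so that induction on the level builds a weight
  from the leaves of the dyadic tree to its root.\<close>

definition dyadic_block :: "nat \<Rightarrow> nat \<Rightarrow> nat set" where
  "dyadic_block m i = {k. k div 2 ^ m = i}"

lemma finite_dyadic_block [simp]: "finite (dyadic_block m i)"
proof (rule finite_subset)
  have "k < Suc i * 2 ^ m" if "k div 2 ^ m = i" for k
    using that by (subst div_less_iff_less_mult[symmetric]) auto
  then show "dyadic_block m i \<subseteq> {..<Suc i * 2 ^ m}" by (auto simp: dyadic_block_def)
qed simp

lemma dyadic_block_Suc: "dyadic_block (Suc m) i = dyadic_block m (2 * i) \<union> dyadic_block m (2 * i + 1)"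
proof -
  have half: "x div 2 = i \<longleftrightarrow> x = 2 * i \<or> x = 2 * i + 1" for x :: nat by presburger
  have "k div 2 ^ Suc m = (k div 2 ^ m) div 2" for k :: nat
    by (simp only: power_Suc2 div_mult2_eq)
  then show ?thesis by (auto simp: dyadic_block_def half)
qed

lemma dyadic_block_coarsen:
  assumes "k \<in> dyadic_block m' i'" "m' \<le> m"
  shows "k div 2 ^ m = i' div 2 ^ (m - m')"
proof -
  have "(2::nat) ^ m = 2 ^ m' * 2 ^ (m - m')" using assms(2) by (simp flip: power_add)
  then show ?thesis using assms(1) by (simp add: dyadic_block_def div_mult2_eq)
qed

text \<open>Max-flow min-cut on the dyadic tree: \<open>p\<close> is a flow into the leaves
  satisfying \<open>P\<close>, with capacity \<open>\<omega> m'\<close> at each block of level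
  \<open>m'\<close>, and \<open>D\<close> is a cut that costs no more than the flow. Since the cut
  covers these leaves, a lower bound on the cost of covers becomes a lower bound on the
  mass.\<close>

lemma discrete_frostman:
  fixes \<omega> :: "nat \<Rightarrow> real"
  assumes \<omega>: "\<And>m. 0 \<le> \<omega> m"
  shows "\<exists>p D. (\<forall>k. 0 \<le> p k) \<and> (\<forall>k. p k \<noteq> 0 \<longrightarrow> P k \<and> k \<in> dyadic_block m i)
    \<and> (\<forall>m' i'. m' \<le> m \<longrightarrow> sum p (dyadic_block m' i') \<le> \<omega> m')
    \<and> finite D \<and> (\<forall>d\<in>D. fst d \<le> m)
    \<and> {k \<in> dyadic_block m i. P k} \<subseteq> (\<Union>d\<in>D. dyadic_block (fst d) (snd d))
    \<and> (\<Sum>d\<in>D. \<omega> (fst d)) \<le> sum p (dyadic_block m i)"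
proof (induction m arbitrary: i)
  case 0
  have [simp]: "dyadic_block 0 i = {i}" for i by (auto simp: dyadic_block_def)
  show ?case
  proof (cases "P i")
    case True
    then show ?thesis
      by (intro exI[of _ "\<lambda>k. if k = i then \<omega> 0 else 0"] exI[of _ "{(0, i)}"]) (auto simp: \<omega>)
  next
    case False
    then show ?thesis
      by (intro exI[of _ "\<lambda>k. 0"] exI[of _ "{}"]) (auto simp: \<omega>)
  qed
next
  case (Suc m)
  obtain p1 D1 where p1: "\<forall>k. 0 \<le> p1 k" "\<forall>k. p1 k \<noteq> 0 \<longrightarrow> P k \<and> k \<in> dyadic_block m (2 * i)"
      "\<forall>m' i'. m' \<le> m \<longrightarrow> sum p1 (dyadic_block m' i') \<le> \<omega> m'"
    and D1: "finite D1" "\<forall>d\<in>D1. fst d \<le> m"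
      "{k \<in> dyadic_block m (2 * i). P k} \<subseteq> (\<Union>d\<in>D1. dyadic_block (fst d) (snd d))"
      "(\<Sum>d\<in>D1. \<omega> (fst d)) \<le> sum p1 (dyadic_block m (2 * i))"
    using Suc[of "2 * i"] by (elim exE conjE) (rule that)
  note p1 = p1(1)[rule_format] p1(2)[rule_format] p1(3)[rule_format] and D1 = D1(1) D1(2)[rule_format] D1(3,4)
  obtain p2 D2 where p2: "\<forall>k. 0 \<le> p2 k" "\<forall>k. p2 k \<noteq> 0 \<longrightarrow> P k \<and> k \<in> dyadic_block m (2 * i + 1)"
      "\<forall>m' i'. m' \<le> m \<longrightarrow> sum p2 (dyadic_block m' i') \<le> \<omega> m'"
    and D2: "finite D2" "\<forall>d\<in>D2. fst d \<le> m"
      "{k \<in> dyadic_block m (2 * i + 1). P k} \<subseteq> (\<Union>d\<in>D2. dyadic_block (fst d) (snd d))"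
      "(\<Sum>d\<in>D2. \<omega> (fst d)) \<le> sum p2 (dyadic_block m (2 * i + 1))"
    using Suc[of "2 * i + 1"] by (elim exE conjE) (rule that)
  note p2 = p2(1)[rule_format] p2(2)[rule_format] p2(3)[rule_format] and D2 = D2(1) D2(2)[rule_format] D2(3,4)
  \<comment> \<open>If the two halves together exceed \<open>\<omega> (Suc m)\<close>, scale the weight down and cover by the parent block alone.\<close>
  define p where "p k = p1 k + p2 k" for k
  define T where "T = sum p (dyadic_block (Suc m) i)"
  have p0: "0 \<le> p k" for k using p1(1) p2(1) by (simp add: p_def)
  have supp: "P k \<and> k \<in> dyadic_block (Suc m) i" if "p k \<noteq> 0" for k
    using p1(2)[of k] p2(2)[of k] that unfolding dyadic_block_Suc p_def by (cases "p1 k = 0") auto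
  \<comment> \<open>Such a block lies inside a single block of level \<open>m\<close>, so at most
    one of \<open>p1\<close> and \<open>p2\<close> is nonzero on it.\<close>
  have small: "sum p (dyadic_block m' i') \<le> \<omega> m'" if "m' \<le> m" for m' i'
  proof (cases "i' div 2 ^ (m - m') = 2 * i")
    case True
    have "p2 k = 0" if k: "k \<in> dyadic_block m' i'" for k
      using dyadic_block_coarsen[OF k \<open>m' \<le> m\<close>] p2(2)[of k] True by (auto simp: dyadic_block_def)
    then have "sum p (dyadic_block m' i') = sum p1 (dyadic_block m' i')"
      by (intro sum.cong) (auto simp: p_def)
    then show ?thesis using p1(3)[OF that] by simp
  next
    case False
    have "p1 k = 0" if k: "k \<in> dyadic_block m' i'" for k
      using dyadic_block_coarsen[OF k \<open>m' \<le> m\<close>] p1(2)[of k] False by (auto simp: dyadic_block_def)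
    then have "sum p (dyadic_block m' i') = sum p2 (dyadic_block m' i')"
      by (intro sum.cong) (auto simp: p_def)
    then show ?thesis using p2(3)[OF that] by simp
  qed
  have other: "sum p (dyadic_block (Suc m) i') = 0" if "i' \<noteq> i" for i'
  proof (rule sum.neutral, rule ballI)
    fix k assume "k \<in> dyadic_block (Suc m) i'"
    then show "p k = 0" using supp[of k] that by (auto simp: dyadic_block_def)
  qed
  show ?case
  proof (cases "T \<le> \<omega> (Suc m)")
    case True
    have "(\<Sum>d\<in>D1 \<union> D2. \<omega> (fst d)) \<le> (\<Sum>d\<in>D1. \<omega> (fst d)) + (\<Sum>d\<in>D2. \<omega> (fst d))"
      using sum.union_inter[OF D1(1) D2(1), of "\<lambda>d. \<omega> (fst d)"] sum_nonneg[of "D1 \<inter> D2" "\<lambda>d. \<omega> (fst d)"] \<omega> by simp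
    also have "\<dots> \<le> sum p1 (dyadic_block m (2 * i)) + sum p2 (dyadic_block m (2 * i + 1))"
      using D1(4) D2(4) by simp
    also have "\<dots> \<le> sum p (dyadic_block m (2 * i)) + sum p (dyadic_block m (2 * i + 1))"
      using p1(1) p2(1) by (intro add_mono sum_mono) (auto simp: p_def)
    also have "\<dots> = T"
      unfolding T_def dyadic_block_Suc by (rule sum.union_disjoint[symmetric], simp, simp) (auto simp: dyadic_block_def)
    finally have "(\<Sum>d\<in>D1 \<union> D2. \<omega> (fst d)) \<le> sum p (dyadic_block (Suc m) i)" by (simp add: T_def)
    moreover have "sum p (dyadic_block m' i') \<le> \<omega> m'" if "m' \<le> Suc m" for m' i'
    proof (cases "m' \<le> m")
      case False
      then have "m' = Suc m" using that by simp
      then show ?thesis using True other[of i'] \<omega> by (cases "i' = i") (auto simp: T_def)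
    qed (rule small)
    moreover have "{k \<in> dyadic_block (Suc m) i. P k} \<subseteq> (\<Union>d\<in>D1 \<union> D2. dyadic_block (fst d) (snd d))"
      using D1(3) D2(3) unfolding dyadic_block_Suc by blast
    moreover have "\<forall>d\<in>D1 \<union> D2. fst d \<le> Suc m" using D1(2) D2(2) by (auto intro: le_SucI)
    ultimately show ?thesis
      using p0 supp D1(1) D2(1) by (intro exI[of _ p] exI[of _ "D1 \<union> D2"]) simp
  next
    case False
    define r where "r = \<omega> (Suc m) / T"
    have T: "0 < T" using False \<omega>[of "Suc m"] by linarith
    have r: "0 \<le> r" "r \<le> 1" using False T \<omega> by (auto simp: r_def)
    have sum_r: "(\<Sum>k\<in>Z. r * p k) = r * sum p Z" for Z by (simp add: sum_distrib_left)
    have rT: "r * T = \<omega> (Suc m)" using T by (simp add: r_def)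
    have "r * sum p (dyadic_block m' i') \<le> \<omega> m'" if "m' \<le> Suc m" for m' i'
    proof (cases "m' \<le> m")
      case True
      have "r * sum p (dyadic_block m' i') \<le> 1 * sum p (dyadic_block m' i')"
        using r p0 by (intro mult_right_mono sum_nonneg) auto
      then show ?thesis using small[OF True, of i'] by simp
    next
      case False
      then have "m' = Suc m" using that by simp
      then show ?thesis using rT other[of i'] \<omega> by (cases "i' = i") (auto simp: T_def)
    qed
    then show ?thesis
      using p0 supp r rT
      by (intro exI[of _ "\<lambda>k. r * p k"] exI[of _ "{(Suc m, i)}"]) (auto simp: sum_r T_def)
  qed
qed

text \<open>Pieces longer than \<open>\<delta>\<close> need no separate treatment, as one of them
  already costs more than a fixed amount, \<open>\<delta> powr s\<close> at least. The lengths
  \<open>l i\<close> are positive so that \<open>l i powr 0\<close> is 1, in agreement with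
  \<open>diam_powr\<close> on nonempty sets.\<close>

lemma hausdorff_content_pos:
  fixes A :: "'a::metric_space set"
  assumes s: "0 \<le> s" and pos: "hausdorff_measure s A > 0"
  shows "\<exists>c>0. \<forall>(F :: 'i set) U l. finite F \<longrightarrow> A \<subseteq> (\<Union>i\<in>F. U i) \<longrightarrow>
     (\<forall>i\<in>F. bounded (U i) \<and> diameter (U i) \<le> l i \<and> 0 < l i) \<longrightarrow> c \<le> (\<Sum>i\<in>F. l i powr s)"
proof -
  obtain \<delta> where \<delta>: "\<delta> > 0" and e: "(INF U\<in>delta_covers \<delta> A. \<Sum>n. diam_powr s (U n)) > 0"
    using pos unfolding hausdorff_measure_def less_SUP_iff by auto
  define e where "e = (INF U\<in>delta_covers \<delta> A. \<Sum>n. diam_powr s (U n))"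
  \<comment> \<open>The infimum may be infinite; truncation at 1 makes it a positive real.\<close>
  define e' where "e' = enn2real (min e 1)"
  have fin: "min e 1 < top" by (rule le_less_trans[OF min.cobounded2 ennreal_one_less_top])
  have "0 < min e 1" using e by (simp add: e_def)
  with fin have e'0: "0 < e'" by (simp add: e'_def enn2real_positive_iff)
  have e'e: "ennreal e' \<le> e" using fin by (simp add: e'_def)
  define c where "c = min e' (\<delta> powr s)"
  show ?thesis
  proof (intro exI[of _ c] conjI allI impI)
    show "0 < c" using e'0 \<delta> by (simp add: c_def)
    fix F :: "'i set" and U l
    assume F: "finite F" and cov: "A \<subseteq> (\<Union>i\<in>F. U i)"
      and U: "\<forall>i\<in>F. bounded (U i) \<and> diameter (U i) \<le> l i \<and> 0 < l i"
    show "c \<le> (\<Sum>i\<in>F. l i powr s)"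
    proof (rule ccontr)
      assume less: "\<not> c \<le> (\<Sum>i\<in>F. l i powr s)"
      have small: "l i \<le> \<delta>" if i: "i \<in> F" for i
      proof (rule ccontr)
        assume "\<not> l i \<le> \<delta>"
        then have "\<delta> powr s \<le> l i powr s" using s \<delta> by (intro powr_mono2) auto
        also have "\<dots> \<le> (\<Sum>i\<in>F. l i powr s)" using F i by (intro member_le_sum) auto
        finally show False using less by (simp add: c_def)
      qed
      obtain h where h: "bij_betw h {0..<card F} F" using ex_bij_betw_nat_finite[OF F] by auto
      define V where "V n = (if n < card F then U (h n) else {})" for n
      have hF: "h n \<in> F" if "n < card F" for n using h that by (auto simp: bij_betw_def)
      have "V \<in> delta_covers \<delta> A"
        unfolding delta_covers_def
      proof (intro CollectI conjI allI)
        show "A \<subseteq> (\<Union>n. V n)"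
        proof
          fix x assume "x \<in> A"
          then obtain i where i: "i \<in> F" "x \<in> U i" using cov by auto
          then have "i \<in> h ` {0..<card F}" using h by (simp add: bij_betw_def)
          then obtain n where "n < card F" "h n = i" by auto
          then show "x \<in> (\<Union>n. V n)" using i by (auto simp: V_def intro!: exI[of _ n])
        qed
        fix n
        show "bounded (V n)" using U hF by (auto simp: V_def)
        show "diameter (V n) \<le> \<delta>" using U hF small \<delta> by (auto simp: V_def intro: order_trans)
      qed
      then have "e \<le> (\<Sum>n. diam_powr s (V n))" unfolding e_def by (rule INF_lower)
      also have "\<dots> = (\<Sum>n<card F. diam_powr s (V n))"
        by (rule suminf_finite) (auto simp: V_def diam_powr_def)
      also have "\<dots> \<le> (\<Sum>n<card F. ennreal (l (h n) powr s))"
      proof (rule sum_mono)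
        fix n assume n: "n \<in> {..<card F}"
        then have V: "V n = U (h n)" by (simp add: V_def)
        have Un: "bounded (U (h n))" "diameter (U (h n)) \<le> l (h n)" "0 < l (h n)" using U hF n by auto
        show "diam_powr s (V n) \<le> ennreal (l (h n) powr s)"
          unfolding V diam_powr_def
          using Un s diameter_ge_0[of "U (h n)"] by (auto intro!: ennreal_leI powr_mono2)
      qed
      also have "\<dots> = ennreal (\<Sum>n<card F. l (h n) powr s)" by (rule sum_ennreal) auto
      also have "(\<Sum>n<card F. l (h n) powr s) = (\<Sum>i\<in>F. l i powr s)"
        using sum.reindex_bij_betw[OF h, of "\<lambda>i. l i powr s"] by (simp add: atLeast0LessThan)
      finally have "ennreal e' \<le> ennreal (\<Sum>i\<in>F. l i powr s)" using e'e by (rule order_trans[rotated])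
      then have "e' \<le> (\<Sum>i\<in>F. l i powr s)" by (subst (asm) ennreal_le_iff) (auto intro: sum_nonneg)
      then show False using less by (simp add: c_def)
    qed
  qed
qed

section \<open>Weights on the dyadic grid of an interval\<close>

definition grid_index :: "real \<Rightarrow> nat \<Rightarrow> real \<Rightarrow> nat" where
  "grid_index L n a = nat \<lfloor>2 ^ n * ((a + L) / (2 * L))\<rfloor>"

lemma grid_index_bounds:
  assumes "a \<in> {-L..<L}"
  shows "real (grid_index L n a) \<le> 2 ^ n * ((a + L) / (2 * L))"
    and "2 ^ n * ((a + L) / (2 * L)) < real (grid_index L n a) + 1"
    and "grid_index L n a < 2 ^ n"
proof -
  have L: "0 < L" "0 \<le> (a + L) / (2 * L)" "(a + L) / (2 * L) < 1" using assms by auto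
  have x: "0 \<le> 2 ^ n * ((a + L) / (2 * L))" "2 ^ n * ((a + L) / (2 * L)) < 2 ^ n * 1"
    using L by (intro mult_nonneg_nonneg mult_strict_left_mono; simp)+
  then show 1: "real (grid_index L n a) \<le> 2 ^ n * ((a + L) / (2 * L))"
    and "2 ^ n * ((a + L) / (2 * L)) < real (grid_index L n a) + 1"
    unfolding grid_index_def by (simp_all add: of_nat_nat)
  from 1 x have "real (grid_index L n a) < 2 ^ n" by linarith
  then show "grid_index L n a < 2 ^ n" by simp
qed

lemma dyadic_block_iff: "k \<in> dyadic_block m i \<longleftrightarrow> i * 2 ^ m \<le> k \<and> k < (i + 1) * 2 ^ m"
proof -
  have "k div 2 ^ m = i \<longleftrightarrow> i \<le> k div 2 ^ m \<and> k div 2 ^ m < i + 1" by auto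
  also have "\<dots> \<longleftrightarrow> i * 2 ^ m \<le> k \<and> k < (i + 1) * 2 ^ m"
    by (simp add: less_eq_div_iff_mult_less_eq div_less_iff_less_mult)
  finally show ?thesis by (simp add: dyadic_block_def)
qed

definition near_grid :: "real set \<Rightarrow> real \<Rightarrow> nat \<Rightarrow> nat \<Rightarrow> bool" where
  "near_grid A L n k \<longleftrightarrow> (\<exists>a\<in>A. \<bar>(a + L) / (2 * L) - real k / 2 ^ n\<bar> \<le> 1 / 2 ^ n)"

lemma near_grid_index:
  assumes "a \<in> A" "a \<in> {-L..<L}"
  shows "near_grid A L n (grid_index L n a)"
proof -
  have "\<bar>2 ^ n * ((a + L) / (2 * L)) - real (grid_index L n a)\<bar> / 2 ^ n \<le> 1 / 2 ^ n"
    using grid_index_bounds(1,2)[OF assms(2), of n] by (intro divide_right_mono) auto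
  also have "\<bar>2 ^ n * ((a + L) / (2 * L)) - real (grid_index L n a)\<bar> / 2 ^ n
      = \<bar>(2 ^ n * ((a + L) / (2 * L)) - real (grid_index L n a)) / 2 ^ n\<bar>"
    by simp
  also have "(2 ^ n * ((a + L) / (2 * L)) - real (grid_index L n a)) / 2 ^ n = (a + L) / (2 * L) - real (grid_index L n a) / 2 ^ n"
    by (simp add: diff_divide_distrib)
  finally show ?thesis using assms(1) unfolding near_grid_def by blast
qed

text \<open>The map \<open>v\<close> places the cells on the line, so one notion covers both cells
  at their positions and cells at their squared distance from a pin. Scales below the mesh are not
  constrained.\<close>

definition frostman_weight :: "nat \<Rightarrow> (nat \<Rightarrow> real) \<Rightarrow> real \<Rightarrow> real \<Rightarrow> (nat \<Rightarrow> real) \<Rightarrow> bool" where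
  "frostman_weight n v s C p \<longleftrightarrow> (\<forall>k. 0 \<le> p k) \<and> (\<Sum>k<2 ^ n. p k) = 1
     \<and> (\<forall>i b. i \<le> n \<longrightarrow> (\<Sum>k | k < 2 ^ n \<and> b \<le> v k \<and> v k < b + 1 / 2 ^ i. p k) \<le> C * (1 / 2 ^ i) powr s)"

text \<open>With the capacities \<open>l m powr s\<close>, a cut pulls back to a cover of
  \<open>A\<close> of the same cost, so the flow has mass at least the content bound
  \<open>c\<close>. As \<open>c\<close> does not depend on \<open>n\<close>, neither does
  \<open>C\<close> after normalization.\<close>

lemma frostman_grid:
  fixes A :: "real set"
  assumes A: "A \<subseteq> {-L..<L}" and L: "0 < L" and s: "0 \<le> s" and pos: "hausdorff_measure s A > 0"
  shows "\<exists>C\<ge>1. \<forall>n. \<exists>p. frostman_weight n (\<lambda>k. real k / 2 ^ n) s C p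
           \<and> (\<forall>k. p k \<noteq> 0 \<longrightarrow> k < 2 ^ n \<and> near_grid A L n k)"
proof -
  obtain c where c: "c > 0" and content: "\<And>(F :: (nat \<times> nat) set) U l. finite F \<Longrightarrow> A \<subseteq> (\<Union>i\<in>F. U i) \<Longrightarrow>
     (\<And>i. i \<in> F \<Longrightarrow> bounded (U i) \<and> diameter (U i) \<le> l i \<and> 0 < l i) \<Longrightarrow> c \<le> (\<Sum>i\<in>F. l i powr s)"
    using hausdorff_content_pos[OF s pos] by metis
  \<comment> \<open>2 for the blocks met by an interval, \<open>(2 * L) powr s\<close> for rescaling
    to the unit interval, \<open>1 / c\<close> for normalization.\<close>
  define C where "C = max 1 (2 * (2 * L) powr s / c)"
  show ?thesis
  proof (intro exI[of _ C] conjI allI)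
    show "1 \<le> C" by (simp add: C_def)
    fix n
    define \<kappa> where "\<kappa> = grid_index L n"
    define l where "l m = 2 * L * 2 ^ m / 2 ^ n" for m :: nat
    have l0: "0 < l m" for m using L by (simp add: l_def)
    obtain p D where p: "\<forall>k. 0 \<le> p k" "\<forall>k. p k \<noteq> 0 \<longrightarrow> k \<in> \<kappa> ` A \<and> k \<in> dyadic_block n 0"
        "\<forall>m' i'. m' \<le> n \<longrightarrow> sum p (dyadic_block m' i') \<le> l m' powr s"
      and D: "finite D" "\<forall>d\<in>D. fst d \<le> n" "{k \<in> dyadic_block n 0. k \<in> \<kappa> ` A} \<subseteq> (\<Union>d\<in>D. dyadic_block (fst d) (snd d))"
        "(\<Sum>d\<in>D. l (fst d) powr s) \<le> sum p (dyadic_block n 0)"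
      using discrete_frostman[where \<omega> = "\<lambda>m. l m powr s" and m = n and P = "\<lambda>k. k \<in> \<kappa> ` A" and i = 0, OF powr_ge_zero]
      by (elim exE conjE) (rule that)
    have block_n: "dyadic_block n 0 = {..<2 ^ n}" by (auto simp: dyadic_block_iff)
    define T where "T = (\<Sum>k<2 ^ n. p k)"
    have "c \<le> (\<Sum>d\<in>D. l (fst d) powr s)"
    proof (rule content[where U = "\<lambda>d. {a \<in> A. \<kappa> a \<in> dyadic_block (fst d) (snd d)}"])
      show "A \<subseteq> (\<Union>d\<in>D. {a \<in> A. \<kappa> a \<in> dyadic_block (fst d) (snd d)})"
      proof
        fix a assume a: "a \<in> A"
        then have "\<kappa> a \<in> {k \<in> dyadic_block n 0. k \<in> \<kappa> ` A}"
          using grid_index_bounds(3)[of a L n] A by (auto simp: block_n \<kappa>_def)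
        then show "a \<in> (\<Union>d\<in>D. {a \<in> A. \<kappa> a \<in> dyadic_block (fst d) (snd d)})"
          using D(3) a by blast
      qed
      fix d
      let ?U = "{a \<in> A. \<kappa> a \<in> dyadic_block (fst d) (snd d)}"
      have "dist x y \<le> l (fst d)" if xy: "x \<in> ?U" "y \<in> ?U" for x y
      proof -
        have cell: "real (snd d) * 2 ^ fst d \<le> 2 ^ n * ((z + L) / (2 * L)) \<and> 2 ^ n * ((z + L) / (2 * L)) < (real (snd d) + 1) * 2 ^ fst d"
          if z: "z \<in> ?U" for z
        proof -
          have "snd d * 2 ^ fst d \<le> \<kappa> z" "\<kappa> z + 1 \<le> (snd d + 1) * 2 ^ fst d"
            using z by (auto simp: dyadic_block_iff)
          then have "real (snd d * 2 ^ fst d) \<le> real (\<kappa> z)" "real (\<kappa> z + 1) \<le> real ((snd d + 1) * 2 ^ fst d)"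
            by (simp_all only: of_nat_le_iff)
          then have k: "real (snd d) * 2 ^ fst d \<le> real (\<kappa> z)" "real (\<kappa> z) + 1 \<le> (real (snd d) + 1) * 2 ^ fst d"
            by (simp_all add: algebra_simps)
          have "z \<in> {-L..<L}" using z A by blast
          then show ?thesis
            using grid_index_bounds(1,2)[of z L n] k unfolding \<kappa>_def by linarith
        qed
        have "\<bar>2 ^ n * ((x + L) / (2 * L)) - 2 ^ n * ((y + L) / (2 * L))\<bar> \<le> 2 ^ fst d"
          using cell[OF xy(1)] cell[OF xy(2)] by (simp add: abs_le_iff distrib_right)
        also have "2 ^ n * ((x + L) / (2 * L)) - 2 ^ n * ((y + L) / (2 * L)) = (2 ^ n / (2 * L)) * (x - y)"
          using L by (simp add: field_simps)
        finally have "(2 ^ n / (2 * L)) * \<bar>x - y\<bar> \<le> 2 ^ fst d" using L by (simp add: abs_mult)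
        then show ?thesis using L by (simp add: dist_real_def l_def field_simps)
      qed
      then show "bounded ?U \<and> diameter ?U \<le> l (fst d) \<and> 0 < l (fst d)"
        using l0[of "fst d"] by (auto simp: bounded_two_points dist_norm intro!: diameter_le)
    qed (use D in auto)
    then have T: "c \<le> T" using D(4) by (simp add: T_def block_n)
    then have T0: "0 < T" using c by linarith
    have "(\<Sum>k | k < 2 ^ n \<and> b \<le> real k / 2 ^ n \<and> real k / 2 ^ n < b + 1 / 2 ^ i. p k / T) \<le> C * (1 / 2 ^ i) powr s"
      if i: "i \<le> n" for i b
    proof -
      let ?I = "{k. k < 2 ^ n \<and> b \<le> real k / 2 ^ n \<and> real k / 2 ^ n < b + 1 / 2 ^ i}"
      define m where "m = n - i"
      have pw: "(2::real) ^ n = 2 ^ m * 2 ^ i" using i by (simp add: m_def flip: power_add)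
      have fin: "finite ?I" by simp
      have "sum p ?I \<le> 2 * l m powr s"
      proof (cases "?I = {}")
        case False
        \<comment> \<open>All cells of the interval lie in \<open>{k0..<k0 + 2 ^ m}\<close>, which
          meets at most two adjacent blocks.\<close>
        define k0 where "k0 = Min ?I"
        have k0: "k0 \<in> ?I" unfolding k0_def by (rule Min_in[OF fin False])
        define q where "q = k0 div 2 ^ m"
        have "?I \<subseteq> dyadic_block m q \<union> dyadic_block m (q + 1)"
        proof
          fix k assume k: "k \<in> ?I"
          have le: "k0 \<le> k" unfolding k0_def by (rule Min_le[OF fin k])
          have "real k / 2 ^ n < real k0 / 2 ^ n + 1 / 2 ^ i" using k k0 by auto
          then have "real k < real k0 + 2 ^ m" unfolding pw by (simp add: field_simps)
          then have "real k < real (k0 + 2 ^ m)" by simp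
          then have lt: "k < k0 + 2 ^ m" by (simp only: of_nat_less_iff)
          have "k0 \<in> dyadic_block m q" by (simp add: dyadic_block_def q_def)
          then have "q * 2 ^ m \<le> k0" "k0 < (q + 1) * 2 ^ m" by (simp_all add: dyadic_block_iff)
          then show "k \<in> dyadic_block m q \<union> dyadic_block m (q + 1)"
            using le lt by (auto simp: dyadic_block_iff)
        qed
        then have "sum p ?I \<le> sum p (dyadic_block m q \<union> dyadic_block m (q + 1))"
          using p(1) by (intro sum_mono2) auto
        also have "\<dots> = sum p (dyadic_block m q) + sum p (dyadic_block m (q + 1))"
          by (rule sum.union_disjoint, simp, simp) (auto simp: dyadic_block_def)
        also have "\<dots> \<le> 2 * l m powr s" using p(3)[rule_format, of m q] p(3)[rule_format, of m "q + 1"] by (simp add: m_def)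
        finally show ?thesis .
      next
        case True
        then show ?thesis unfolding True by simp
      qed
      also have "l m = 2 * L * (1 / 2 ^ i)" unfolding l_def pw by simp
      also have "(2 * L * (1 / 2 ^ i)) powr s = (2 * L) powr s * (1 / 2 ^ i) powr s"
        by (rule powr_mult)
      finally have "sum p ?I / T \<le> 2 * ((2 * L) powr s * (1 / 2 ^ i) powr s) / T"
        using T0 by (intro divide_right_mono) auto
      also have "\<dots> \<le> 2 * ((2 * L) powr s * (1 / 2 ^ i) powr s) / c"
        using T c T0 by (intro divide_left_mono) auto
      also have "\<dots> = (2 * (2 * L) powr s / c) * (1 / 2 ^ i) powr s" by simp
      also have "\<dots> \<le> C * (1 / 2 ^ i) powr s" by (intro mult_right_mono) (auto simp: C_def)
      finally show ?thesis by (simp only: sum_divide_distrib)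
    qed
    moreover have "(\<Sum>k<2 ^ n. p k / T) = 1" using T0 by (simp add: T_def flip: sum_divide_distrib)
    moreover have "k < 2 ^ n \<and> near_grid A L n k" if "p k / T \<noteq> 0" for k
    proof -
      have "k \<in> \<kappa> ` A" "k < 2 ^ n" using p(2) that by (auto simp: block_n)
      then show ?thesis using near_grid_index A by (auto simp: \<kappa>_def)
    qed
    ultimately show "\<exists>p. frostman_weight n (\<lambda>k. real k / 2 ^ n) s C p \<and> (\<forall>k. p k \<noteq> 0 \<longrightarrow> k < 2 ^ n \<and> near_grid A L n k)"
      using p(1) T0 by (intro exI[of _ "\<lambda>k. p k / T"]) (auto simp: frostman_weight_def)
  qed
qed

text \<open>
  Squaring is not bi-Lipschitz near the pin \<open>a\<close>, so for \<open>s > 0\<close> the weight is restricted to a fixed distance from \<open>a\<close>;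
  this keeps at least half of the mass. For \<open>s = 0\<close> the ball condition is void.
\<close>

lemma frostman_pinned:
  fixes A :: "real set"
  assumes A: "A \<subseteq> {-L..<L}" and L: "0 < L" and s: "0 \<le> s" and pos: "hausdorff_measure s A > 0"
  shows "\<exists>C\<ge>1. \<exists>n0. \<forall>n\<ge>n0. \<exists>a q. a < 2 ^ n \<and> near_grid A L n a
           \<and> frostman_weight n (\<lambda>k. (real k / 2 ^ n - real a / 2 ^ n)\<^sup>2) s C q
           \<and> (\<forall>k. q k \<noteq> 0 \<longrightarrow> k < 2 ^ n \<and> near_grid A L n k)"
proof -
  obtain C where C: "1 \<le> C" and Cn: "\<And>n. \<exists>p. frostman_weight n (\<lambda>k. real k / 2 ^ n) s C p
           \<and> (\<forall>k. p k \<noteq> 0 \<longrightarrow> k < 2 ^ n \<and> near_grid A L n k)"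
    using frostman_grid[OF assms] by blast
  show ?thesis
  proof (cases "s = 0")
    case True
    show ?thesis
    proof (rule exI[of _ C], rule conjI[OF C], rule exI[of _ 0], intro allI impI)
      fix n :: nat
      obtain p where p: "frostman_weight n (\<lambda>k. real k / 2 ^ n) s C p"
        and supp: "\<forall>k. p k \<noteq> 0 \<longrightarrow> k < 2 ^ n \<and> near_grid A L n k" using Cn[of n] by blast
      have p0: "0 \<le> p k" and p1: "(\<Sum>k<2 ^ n. p k) = 1" for k using p by (auto simp: frostman_weight_def)
      obtain a where a: "p a \<noteq> 0" using p1 by (metis sum.neutral zero_neq_one)
      have "(\<Sum>k | k < 2 ^ n \<and> b \<le> (real k / 2 ^ n - real a / 2 ^ n)\<^sup>2 \<and> (real k / 2 ^ n - real a / 2 ^ n)\<^sup>2 < b + 1 / 2 ^ i. p k)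
          \<le> C * (1 / 2 ^ i) powr s" for i b
      proof -
        have "(\<Sum>k | k < 2 ^ n \<and> b \<le> (real k / 2 ^ n - real a / 2 ^ n)\<^sup>2 \<and> (real k / 2 ^ n - real a / 2 ^ n)\<^sup>2 < b + 1 / 2 ^ i. p k)
          \<le> (\<Sum>k<2 ^ n. p k)" using p0 by (intro sum_mono2) auto
        then show ?thesis using p1 C True by simp
      qed
      then show "\<exists>a q. a < 2 ^ n \<and> near_grid A L n a
           \<and> frostman_weight n (\<lambda>k. (real k / 2 ^ n - real a / 2 ^ n)\<^sup>2) s C q
           \<and> (\<forall>k. q k \<noteq> 0 \<longrightarrow> k < 2 ^ n \<and> near_grid A L n k)"
        using supp a p0 p1 by (intro exI[of _ a] exI[of _ p]) (auto simp: frostman_weight_def)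
    qed
  next
    case False
    then have s0: "0 < s" using s by simp
    have "(1 / 2 :: real) powr s < 1" using powr_less_mono2[OF s0, of "1 / 2" 1] by simp
    \<comment> \<open>Chosen so that intervals of length \<open>1 / 2 ^ m0\<close> have mass at most
      1/4; two of them cover the excluded neighbourhood of the pin.\<close>
    then obtain m0 where m0': "((1 / 2 :: real) powr s) ^ m0 < 1 / (4 * C)"
      using real_arch_pow_inv[of "1 / (4 * C)" "(1 / 2) powr s"] C by auto
    have pw: "((1 / 2 :: real) powr s) ^ m0 = (1 / 2 ^ m0) powr s"
    proof -
      have "1 / 2 ^ m0 = (1 / 2 :: real) powr real m0" by (simp add: powr_realpow power_one_over)
      moreover have "((1 / 2 :: real) powr s) ^ m0 = ((1 / 2) powr s) powr real m0" by (simp add: powr_realpow)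
      ultimately show ?thesis by (simp only: powr_powr mult.commute)
    qed
    have m0: "C * (1 / 2 ^ m0) powr s \<le> 1 / 4" using m0' C unfolding pw by (simp add: field_simps)
    \<comment> \<open>2 from dividing by \<open>T\<close>, which is at least 1/2; 2 for the two
      sides of the pin; \<open>(2 ^ m0) powr s\<close> because undoing the square away from the pin
      stretches lengths by at most \<open>2 ^ m0\<close>.\<close>
    define C' where "C' = 4 * (C * (2 ^ m0) powr s)"
    have C'1: "1 \<le> C'"
    proof -
      have "1 \<le> (2 ^ m0 :: real) powr s" using s by (intro ge_one_powr_ge_zero) auto
      then have "1 * 1 \<le> C * (2 ^ m0) powr s" using C by (intro mult_mono) auto
      then show ?thesis by (simp add: C'_def)
    qed
    show ?thesis
    proof (rule exI[of _ C'], rule conjI[OF C'1], rule exI[of _ m0], intro allI impI)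
      fix n assume n: "m0 \<le> n"
      obtain p where p: "frostman_weight n (\<lambda>k. real k / 2 ^ n) s C p"
        and supp: "\<forall>k. p k \<noteq> 0 \<longrightarrow> k < 2 ^ n \<and> near_grid A L n k" using Cn[of n] by blast
      have p0: "0 \<le> p k" and p1: "(\<Sum>k<2 ^ n. p k) = 1"
        and ball: "i \<le> n \<Longrightarrow> (\<Sum>k | k < 2 ^ n \<and> b \<le> real k / 2 ^ n \<and> real k / 2 ^ n < b + 1 / 2 ^ i. p k) \<le> C * (1 / 2 ^ i) powr s"
        for k i b using p by (auto simp: frostman_weight_def)
      obtain a where a: "p a \<noteq> 0" using p1 by (metis sum.neutral zero_neq_one)
      define x where "x k = real k / 2 ^ n - real a / 2 ^ n" for k
      define far where "far k \<longleftrightarrow> 1 / 2 ^ m0 \<le> \<bar>x k\<bar>" for k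
      define T where "T = (\<Sum>k | k < 2 ^ n \<and> far k. p k)"
      have T: "1 / 2 \<le> T"
      proof -
        let ?I = "\<lambda>b. {k. k < 2 ^ n \<and> b \<le> real k / 2 ^ n \<and> real k / 2 ^ n < b + 1 / 2 ^ m0}"
        have "(\<Sum>k<2 ^ n. p k) \<le> sum p ({k. k < 2 ^ n \<and> far k} \<union> (?I (real a / 2 ^ n) \<union> ?I (real a / 2 ^ n - 1 / 2 ^ m0)))"
          using p0 by (intro sum_mono2) (auto simp: far_def x_def abs_if not_le split: if_splits)
        also have "\<dots> \<le> T + (sum p (?I (real a / 2 ^ n)) + sum p (?I (real a / 2 ^ n - 1 / 2 ^ m0)))"
        proof -
          have un: "sum p (U \<union> V) \<le> sum p U + sum p V" if "finite U" "finite V" for U V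
            using sum.union_inter[OF that, of p] sum_nonneg[of "U \<inter> V" p] p0 by simp
          show ?thesis unfolding T_def by (intro order_trans[OF un] add_left_mono un) auto
        qed
        also have "\<dots> \<le> T + (1 / 4 + 1 / 4)"
          by (intro add_left_mono add_mono order_trans[OF ball m0] n)
        finally show ?thesis using p1 by simp
      qed
      define q where "q k = (if k < 2 ^ n \<and> far k then p k / T else 0)" for k
      have q0: "0 \<le> q k" for k using p0 T by (simp add: q_def)
      have q_le: "q k \<le> 2 * p k" for k
      proof -
        have "p k / T \<le> p k / (1 / 2)" using p0 T by (intro divide_left_mono) auto
        then show ?thesis using p0[of k] by (simp add: q_def)
      qed
      have "(\<Sum>k<2 ^ n. q k) = (\<Sum>k | k < 2 ^ n \<and> far k. p k / T)"
      proof -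
        have "(\<Sum>k<2 ^ n. q k) = (\<Sum>k | k < 2 ^ n \<and> far k. q k)"
          by (intro sum.mono_neutral_right) (auto simp: q_def)
        then show ?thesis by (simp add: q_def)
      qed
      then have q1: "(\<Sum>k<2 ^ n. q k) = 1" using T by (simp add: T_def flip: sum_divide_distrib)
      \<comment> \<open>For \<open>i < m0\<close> the right side is at least 1, the total mass.
        Otherwise \<open>Z\<close> fits into an interval of length \<open>1 / 2 ^ (i - m0)\<close>
        starting at its least cell.\<close>
      have cluster: "sum p Z \<le> C * (2 ^ m0) powr s * (1 / 2 ^ i) powr s"
        if i: "i \<le> n" and Z: "Z \<subseteq> {..<2 ^ n}" and close: "\<And>k k'. k \<in> Z \<Longrightarrow> k' \<in> Z \<Longrightarrow> x k - x k' < 2 ^ m0 / 2 ^ i" for i Z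
      proof -
        have fin: "finite Z" using Z finite_subset by blast
        have pm: "(2 ^ m0) powr s * (1 / 2 ^ i) powr s = (2 ^ m0 / 2 ^ i :: real) powr s"
          by (simp add: powr_mult[symmetric])
        show ?thesis
        proof (cases "m0 \<le> i \<and> Z \<noteq> {}")
          case True
          define k0 where "k0 = Min Z"
          have k0: "k0 \<in> Z" using fin True by (auto simp: k0_def)
          have e: "(2 ^ m0 / 2 ^ i :: real) = 1 / 2 ^ (i - m0)" using True by (simp add: power_diff)
          have "sum p Z \<le> (\<Sum>k | k < 2 ^ n \<and> real k0 / 2 ^ n \<le> real k / 2 ^ n \<and> real k / 2 ^ n < real k0 / 2 ^ n + 1 / 2 ^ (i - m0). p k)"
          proof (rule sum_mono2)
            show "Z \<subseteq> {k. k < 2 ^ n \<and> real k0 / 2 ^ n \<le> real k / 2 ^ n \<and> real k / 2 ^ n < real k0 / 2 ^ n + 1 / 2 ^ (i - m0)}"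
            proof
              fix k assume k: "k \<in> Z"
              have "k0 \<le> k" using fin k by (simp add: k0_def)
              then have "real k0 / 2 ^ n \<le> real k / 2 ^ n" by (intro divide_right_mono) auto
              then show "k \<in> {k. k < 2 ^ n \<and> real k0 / 2 ^ n \<le> real k / 2 ^ n \<and> real k / 2 ^ n < real k0 / 2 ^ n + 1 / 2 ^ (i - m0)}"
                using close[OF k k0] k Z unfolding e x_def by auto
            qed
          qed (use p0 in auto)
          also have "\<dots> \<le> C * (1 / 2 ^ (i - m0)) powr s" by (rule ball) (use i in auto)
          finally show ?thesis unfolding e[symmetric] pm[symmetric] by (simp only: mult.assoc)
        next
          case False
          have nn: "0 \<le> C * ((2 ^ m0) powr s * (1 / 2 ^ i) powr s)" using C by (intro mult_nonneg_nonneg) auto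
          show ?thesis
          proof (cases "Z = {}")
            case True
            then show ?thesis using nn by (simp add: mult.assoc)
          next
            case ne: False
            then have "i \<le> m0" using False by simp
            then have "(2::real) ^ i \<le> 2 ^ m0" by (intro power_increasing) auto
            then have "1 \<le> (2 ^ m0 / 2 ^ i :: real) powr s" using s by (intro ge_one_powr_ge_zero) auto
            then have "1 * 1 \<le> C * (2 ^ m0 / 2 ^ i) powr s" using C by (intro mult_mono) auto
            moreover have "sum p Z \<le> (\<Sum>k<2 ^ n. p k)" using p0 Z by (intro sum_mono2) auto
            ultimately show ?thesis using p1 by (simp add: pm mult.assoc)
          qed
        qed
      qed
      have qball: "(\<Sum>k | k < 2 ^ n \<and> b \<le> (x k)\<^sup>2 \<and> (x k)\<^sup>2 < b + 1 / 2 ^ i. q k) \<le> C' * (1 / 2 ^ i) powr s"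
        if i: "i \<le> n" for i b
      proof -
        let ?I = "{k. k < 2 ^ n \<and> b \<le> (x k)\<^sup>2 \<and> (x k)\<^sup>2 < b + 1 / 2 ^ i}"
        let ?P = "{k \<in> ?I. far k \<and> 0 < x k}" and ?M = "{k \<in> ?I. far k \<and> x k < 0}"
        \<comment> \<open>The difference of squares is (y - z)(y + z), and y + z is at least
          \<open>1 / 2 ^ m0\<close>.\<close>
        have gap: "y - z < 2 ^ m0 / 2 ^ i"
          if yz: "1 / 2 ^ m0 \<le> y" "1 / 2 ^ m0 \<le> z" "y\<^sup>2 < b + 1 / 2 ^ i" "b \<le> z\<^sup>2" for y z :: real
        proof (cases "y \<le> z")
          case True
          then have "y - z \<le> 0" by simp
          also have "0 < (2 ^ m0 / 2 ^ i :: real)" by simp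
          finally show ?thesis .
        next
          case False
          have "(y - z) * (1 / 2 ^ m0) \<le> (y - z) * (y + z)"
          proof (rule mult_left_mono)
            have "0 < (1 / 2 ^ m0 :: real)" by simp
            then show "1 / 2 ^ m0 \<le> y + z" using yz(1,2) by linarith
          qed (use False in simp)
          also have "\<dots> = y\<^sup>2 - z\<^sup>2" by (simp add: power2_eq_square algebra_simps)
          also have "\<dots> < 1 / 2 ^ i" using yz by linarith
          finally have "(y - z) / 2 ^ m0 < 1 / 2 ^ i" by simp
          then show ?thesis by (simp add: pos_divide_less_eq)
        qed
        have bp: "sum p ?P \<le> C * (2 ^ m0) powr s * (1 / 2 ^ i) powr s"
        proof (rule cluster[OF i])
          fix k k' assume k: "k \<in> ?P" "k' \<in> ?P"
          then have "1 / 2 ^ m0 \<le> x k" "1 / 2 ^ m0 \<le> x k'" by (auto simp: far_def)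
          then show "x k - x k' < 2 ^ m0 / 2 ^ i" using k by (intro gap) auto
        qed auto
        have bm: "sum p ?M \<le> C * (2 ^ m0) powr s * (1 / 2 ^ i) powr s"
        proof (rule cluster[OF i])
          fix k k' assume k: "k \<in> ?M" "k' \<in> ?M"
          then have "1 / 2 ^ m0 \<le> - x k" "1 / 2 ^ m0 \<le> - x k'" by (auto simp: far_def)
          then have "- x k' - - x k < 2 ^ m0 / 2 ^ i" using k by (intro gap) auto
          then show "x k - x k' < 2 ^ m0 / 2 ^ i" by simp
        qed auto
        have "sum q ?I = sum q (?P \<union> ?M)"
        proof (rule sum.mono_neutral_right)
          show "\<forall>k\<in>?I - (?P \<union> ?M). q k = 0"
          proof
            fix k assume k: "k \<in> ?I - (?P \<union> ?M)"
            have "\<not> far k"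
            proof
              assume f: "far k"
              then have "x k = 0" using k by auto
              moreover have "\<not> 1 / 2 ^ m0 \<le> (0 :: real)" by (simp add: not_le)
              ultimately show False using f unfolding far_def by (simp only: abs_zero)
            qed
            then show "q k = 0" by (simp add: q_def)
          qed
        qed auto
        also have "\<dots> = sum q ?P + sum q ?M" by (rule sum.union_disjoint) auto
        also have "\<dots> \<le> 2 * sum p ?P + 2 * sum p ?M"
          unfolding sum_distrib_left by (intro add_mono sum_mono q_le)
        also have "\<dots> \<le> C' * (1 / 2 ^ i) powr s" using bp bm by (simp add: C'_def)
        finally show ?thesis .
      qed
      have "\<forall>k. q k \<noteq> 0 \<longrightarrow> k < 2 ^ n \<and> near_grid A L n k"
        using supp by (auto simp: q_def)
      moreover have "frostman_weight n (\<lambda>k. (real k / 2 ^ n - real a / 2 ^ n)\<^sup>2) s C' q"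
        using q0 q1 qball unfolding frostman_weight_def x_def by blast
      ultimately show "\<exists>a q. a < 2 ^ n \<and> near_grid A L n a
           \<and> frostman_weight n (\<lambda>k. (real k / 2 ^ n - real a / 2 ^ n)\<^sup>2) s C' q
           \<and> (\<forall>k. q k \<noteq> 0 \<longrightarrow> k < 2 ^ n \<and> near_grid A L n k)"
        using supp a by blast
    qed
  qed
qed

section \<open>Distance sets\<close>

lemma frostman_weight_mono:
  assumes "frostman_weight n v s C p" "C \<le> C'"
  shows "frostman_weight n v s C' p"
  unfolding frostman_weight_def
proof (intro conjI allI impI)
  fix i b assume "i \<le> n"
  then have "(\<Sum>k | k < 2 ^ n \<and> b \<le> v k \<and> v k < b + 1 / 2 ^ i. p k) \<le> C * (1 / 2 ^ i) powr s"
    using assms(1) by (simp add: frostman_weight_def)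
  also have "\<dots> \<le> C' * (1 / 2 ^ i) powr s" using assms(2) by (intro mult_right_mono) auto
  finally show "(\<Sum>k | k < 2 ^ n \<and> b \<le> v k \<and> v k < b + 1 / 2 ^ i. p k) \<le> C' * (1 / 2 ^ i) powr s" .
qed (use assms(1) in \<open>simp_all add: frostman_weight_def\<close>)

lemma hausdorff_measure_pos_imp_nonempty:
  assumes "0 \<le> s" "hausdorff_measure s (A :: 'a::metric_space set) > 0"
  shows "A \<noteq> {}"
proof
  assume "A = {}"
  moreover obtain c where "c > 0" "\<forall>(F :: nat set) (U :: nat \<Rightarrow> 'a set) l. finite F \<longrightarrow> A \<subseteq> (\<Union>i\<in>F. U i) \<longrightarrow>
     (\<forall>i\<in>F. bounded (U i) \<and> diameter (U i) \<le> l i \<and> 0 < l i) \<longrightarrow> c \<le> (\<Sum>i\<in>F. l i powr s)"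
    using hausdorff_content_pos[OF assms] by blast
  ultimately show False by (auto dest!: spec[of _ "{}"])
qed

text \<open>In rescaled coordinates a difference is off by at most \<open>2 / 2 ^ n\<close>; since
  the true and the grid difference add up to at most 2 in modulus, their squares differ by at most
  \<open>4 / 2 ^ n\<close>. The nearby points can be chosen separately in each coordinate because
  the set is a product.\<close>

lemma grid_distance_near:
  fixes A :: "'d::finite \<Rightarrow> real set"
  assumes L: "0 < L" and A: "\<And>j. A j \<subseteq> {-L..<L}"
    and near: "\<And>j. near_grid (A j) L n (k j)" "\<And>j. near_grid (A j) L n (l j)"
    and less: "\<And>j. k j < 2 ^ n" "\<And>j. l j < 2 ^ n"
  shows "\<exists>r\<in>distance_set {x :: real ^ 'd. \<forall>j. x $ j \<in> A j}.
    \<bar>(r / (2 * L))\<^sup>2 - (\<Sum>j\<in>UNIV. (real (k j) / 2 ^ n - real (l j) / 2 ^ n)\<^sup>2)\<bar> \<le> 4 * real CARD('d) / 2 ^ n"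
proof -
  have "\<forall>j. \<exists>a\<in>A j. \<bar>(a + L) / (2 * L) - real (k j) / 2 ^ n\<bar> \<le> 1 / 2 ^ n"
    using near(1) by (simp add: near_grid_def)
  then obtain a where a: "\<And>j. a j \<in> A j" "\<And>j. \<bar>(a j + L) / (2 * L) - real (k j) / 2 ^ n\<bar> \<le> 1 / 2 ^ n" by metis
  have "\<forall>j. \<exists>b\<in>A j. \<bar>(b + L) / (2 * L) - real (l j) / 2 ^ n\<bar> \<le> 1 / 2 ^ n"
    using near(2) by (simp add: near_grid_def)
  then obtain b where b: "\<And>j. b j \<in> A j" "\<And>j. \<bar>(b j + L) / (2 * L) - real (l j) / 2 ^ n\<bar> \<le> 1 / 2 ^ n" by metis
  let ?x = "(\<chi> j. a j) :: real ^ 'd" and ?y = "(\<chi> j. b j) :: real ^ 'd"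
  define t where "t j = (a j + L) / (2 * L) - (b j + L) / (2 * L)" for j
  define t' where "t' j = real (k j) / 2 ^ n - real (l j) / 2 ^ n" for j
  have diff: "\<bar>(t j)\<^sup>2 - (t' j)\<^sup>2\<bar> \<le> 4 / 2 ^ n" for j
  proof -
    have unit: "0 \<le> (z + L) / (2 * L) \<and> (z + L) / (2 * L) \<le> 1" if "z \<in> A j" for z
      using that A[of j] L by (auto simp: divide_le_eq)
    have "\<bar>t j\<bar> \<le> 1" using unit[OF a(1)] unit[OF b(1)] unfolding t_def by linarith
    moreover have gunit: "0 \<le> real m / 2 ^ n \<and> real m / 2 ^ n \<le> 1" if "m < 2 ^ n" for m
    proof -
      have "real m \<le> 2 ^ n" using that by (simp add: less_imp_le)
      then show ?thesis by simp
    qed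
    then have "\<bar>t' j\<bar> \<le> 1" using gunit[OF less(1)[of j]] gunit[OF less(2)[of j]] unfolding t'_def by linarith
    ultimately have sum: "\<bar>t j + t' j\<bar> \<le> 2" by linarith
    have "\<bar>t j - t' j\<bar> \<le> 2 * (1 / 2 ^ n)"
      using a(2)[of j] b(2)[of j] unfolding t_def t'_def by linarith
    then have "\<bar>t j - t' j\<bar> * \<bar>t j + t' j\<bar> \<le> (2 * (1 / 2 ^ n)) * 2"
      using sum by (intro mult_mono) auto
    moreover have "(t j)\<^sup>2 - (t' j)\<^sup>2 = (t j - t' j) * (t j + t' j)"
      by (simp add: power2_eq_square algebra_simps)
    ultimately show ?thesis by (simp add: abs_mult)
  qed
  have "(norm (?x - ?y) / (2 * L))\<^sup>2 = (\<Sum>j\<in>UNIV. (a j - b j)\<^sup>2) / (2 * L)\<^sup>2"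
    by (simp add: power_divide norm_vec_def L2_set_def sum_nonneg)
  also have "\<dots> = (\<Sum>j\<in>UNIV. (t j)\<^sup>2)"
  proof -
    have "t j = (a j - b j) / (2 * L)" for j by (simp add: t_def flip: diff_divide_distrib)
    then show ?thesis by (simp add: power_divide sum_divide_distrib)
  qed
  finally have eq: "(norm (?x - ?y) / (2 * L))\<^sup>2 = (\<Sum>j\<in>UNIV. (t j)\<^sup>2)" .
  have "\<bar>(\<Sum>j\<in>UNIV. (t j)\<^sup>2) - (\<Sum>j\<in>UNIV. (t' j)\<^sup>2)\<bar> \<le> (\<Sum>j\<in>UNIV. \<bar>(t j)\<^sup>2 - (t' j)\<^sup>2\<bar>)"
    unfolding sum_subtractf[symmetric] by (rule sum_abs)
  also have "\<dots> \<le> (\<Sum>j\<in>(UNIV :: 'd set). 4 / 2 ^ n)" by (intro sum_mono diff)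
  finally have "\<bar>(norm (?x - ?y) / (2 * L))\<^sup>2 - (\<Sum>j\<in>UNIV. (t' j)\<^sup>2)\<bar> \<le> 4 * real CARD('d) / 2 ^ n"
    unfolding eq by (simp add: mult.commute)
  moreover have "norm (?x - ?y) \<in> distance_set {x :: real ^ 'd. \<forall>j. x $ j \<in> A j}"
    unfolding distance_set_def using a(1) b(1) by (intro CollectI exI[of _ ?x] exI[of _ ?y]) auto
  ultimately show ?thesis unfolding t'_def by blast
qed

lemma compact_distance_set:
  fixes E :: "'a::real_normed_vector set"
  assumes "compact E" shows "compact (distance_set E)"
proof -
  have "distance_set E = (\<lambda>(x, y). norm (x - y)) ` (E \<times> E)"
    by (auto simp: distance_set_def)
  moreover have "compact \<dots>"
    unfolding case_prod_unfold
    by (intro compact_continuous_image continuous_intros compact_Times assms)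
  ultimately show ?thesis by simp
qed

lemma emeasure_grid_cells_le:
  fixes S :: "int set" and U :: "real set"
  assumes "finite S" "0 < N" "U \<in> sets borel" "\<And>b. b \<in> S \<Longrightarrow> {of_int b / N..<(of_int b + 1) / N} \<subseteq> U"
  shows "ennreal (real (card S) / N) \<le> emeasure lborel U"
proof -
  let ?I = "\<lambda>b::int. {of_int b / N..<(of_int b + 1) / N}"
  have "disjoint_family_on ?I S"
    unfolding disjoint_family_on_def
  proof (intro ballI impI)
    fix b b' :: int assume ne: "b \<noteq> b'"
    show "?I b \<inter> ?I b' = {}"
    proof (rule ccontr)
      assume "?I b \<inter> ?I b' \<noteq> {}"
      then obtain z where "z \<in> ?I b" "z \<in> ?I b'" by blast
      then have "of_int b \<le> z * N" "z * N < of_int b + 1" "of_int b' \<le> z * N" "z * N < of_int b' + 1"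
        using \<open>0 < N\<close> by (auto simp: field_simps)
      then have "b = b'" by linarith
      with ne show False ..
    qed
  qed
  then have "emeasure lborel (\<Union>b\<in>S. ?I b) = (\<Sum>b\<in>S. emeasure lborel (?I b))"
    using assms(1) by (intro sum_emeasure[symmetric]) auto
  also have "\<dots> = (\<Sum>b\<in>S. ennreal (1 / N))"
  proof (rule sum.cong[OF refl])
    fix b
    have "of_int b / N \<le> (of_int b + 1) / N" using assms(2) by (intro divide_right_mono) auto
    moreover have "(of_int b + 1) / N - of_int b / N = 1 / N" by (simp flip: diff_divide_distrib)
    ultimately show "emeasure lborel (?I b) = ennreal (1 / N)" by simp
  qed
  also have "\<dots> = ennreal (real (card S) / N)"
    using assms(2) by (simp add: ennreal_of_nat_eq_real_of_nat flip: ennreal_mult)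
  finally have "ennreal (real (card S) / N) = emeasure lborel (\<Union>b\<in>S. ?I b)" by simp
  also have "\<dots> \<le> emeasure lborel U" using assms(3,4) by (intro emeasure_mono) auto
  finally show ?thesis .
qed

theorem theorem1p4:
  fixes A :: "'d::finite \<Rightarrow> real set"
    and s :: "'d \<Rightarrow> real"
    and E :: "(real ^ 'd) set"
  assumes "CARD('d) \<ge> 2"
    and "compact E"
    and "E = {x. \<forall>j. x $ j \<in> A j}"
    and "\<And>j. s j \<ge> 0"
    and "\<And>j. hausdorff_measure (s j) (A j) > 0"
    and "(\<Sum>j\<in>UNIV. s j) > real CARD('d) ^ 2 / (2 * real CARD('d) - 1)"
  shows "emeasure lebesgue (distance_set E) > 0"
proof (rule ccontr)
  assume "\<not> emeasure lebesgue (distance_set E) > 0"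
  then have null: "emeasure lebesgue (distance_set E) = 0" by (simp add: not_gr_zero)
  define d where "d = real CARD('d)"
  have d1: "1 \<le> d" using assms(1) by (simp add: d_def)

  have "\<forall>j. \<exists>z. z \<in> A j" using hausdorff_measure_pos_imp_nonempty[OF assms(4,5)] by blast
  then obtain z where z: "\<And>j. z j \<in> A j" by metis
  obtain M where M: "\<And>x. x \<in> E \<Longrightarrow> norm x \<le> M"
    using compact_imp_bounded[OF assms(2)] by (auto simp: bounded_iff)
  define L where "L = \<bar>M\<bar> + 1"
  have L: "0 < L" by (simp add: L_def)
  have AL: "A j \<subseteq> {-L..<L}" for j
  proof
    fix x assume x: "x \<in> A j"
    \<comment> \<open>Completing \<open>x\<close> by the fixed \<open>z\<close> gives a point of
      \<open>E\<close>, so the bound on \<open>E\<close> passes to every factor.\<close>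
    let ?v = "(\<chi> i. if i = j then x else z i) :: real ^ 'd"
    have "?v \<in> E" using x z by (simp add: assms(3))
    then have "norm ?v \<le> M" by (rule M)
    moreover have "\<bar>?v $ j\<bar> \<le> norm ?v" by (rule component_le_norm_cart)
    ultimately have "\<bar>x\<bar> \<le> M" by simp
    then show "x \<in> {-L..<L}" by (auto simp: L_def)
  qed

  have "Min (range s) \<in> range s" by (rule Min_in) auto
  then obtain j0 where "s j0 = Min (range s)" by (metis imageE)
  then have j0: "s j0 \<le> s j" for j by simp
  define J where "J = UNIV - {j0}"
  have UJ: "UNIV = insert j0 J" "j0 \<notin> J" "finite J" by (auto simp: J_def)
  have cardJ: "real (card J) + 1 = d"
    unfolding d_def UJ(1) using UJ(2,3) by simp
  define \<eta> where "\<eta> = s j0 + 2 * (\<Sum>j\<in>J. s j) - (real (card J) + 1)"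
  \<comment> \<open>\<open>\<eta>\<close> equals 2\<alpha> - \<open>s j0\<close> - d, hence is at
    least \<alpha>(2d - 1)/d - d.\<close>
  have \<eta>: "0 < \<eta>"
  proof -
    define \<alpha> where "\<alpha> = (\<Sum>j\<in>UNIV. s j)"
    have \<alpha>: "\<alpha> = s j0 + (\<Sum>j\<in>J. s j)" unfolding \<alpha>_def UJ(1) using UJ(2,3) by simp
    have "(\<Sum>j\<in>(UNIV :: 'd set). s j0) \<le> \<alpha>" unfolding \<alpha>_def by (intro sum_mono j0)
    then have min: "d * s j0 \<le> \<alpha>" by (simp add: d_def)
    have "d\<^sup>2 < \<alpha> * (2 * d - 1)"
      using assms(6) d1 unfolding d_def[symmetric] \<alpha>_def[symmetric] by (simp add: pos_divide_less_eq)
    then have "d * d < d * (2 * \<alpha>) - \<alpha>" by (simp add: power2_eq_square algebra_simps)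
    also have "\<dots> \<le> d * (2 * \<alpha>) - d * s j0" using min by simp
    finally have "d * d < d * (2 * \<alpha> - s j0)" by (simp add: algebra_simps)
    then have "d < 2 * \<alpha> - s j0" using d1 by simp
    then show ?thesis unfolding \<eta>_def cardJ \<alpha> by simp
  qed

  have "\<forall>j. \<exists>C\<ge>1. \<forall>n. \<exists>p. frostman_weight n (\<lambda>k. real k / 2 ^ n) (s j) C p
           \<and> (\<forall>k. p k \<noteq> 0 \<longrightarrow> k < 2 ^ n \<and> near_grid (A j) L n k)"
    using frostman_grid[OF AL L assms(4,5)] by blast
  then obtain Cf where Cf: "\<And>j. 1 \<le> Cf j" and Cfp: "\<And>j n. \<exists>p. frostman_weight n (\<lambda>k. real k / 2 ^ n) (s j) (Cf j) p
           \<and> (\<forall>k. p k \<noteq> 0 \<longrightarrow> k < 2 ^ n \<and> near_grid (A j) L n k)"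
    by metis
  obtain C0 n0 where C0: "1 \<le> C0" and C0q: "\<And>n. n0 \<le> n \<Longrightarrow> \<exists>a q. a < 2 ^ n \<and> near_grid (A j0) L n a
           \<and> frostman_weight n (\<lambda>k. (real k / 2 ^ n - real a / 2 ^ n)\<^sup>2) (s j0) C0 q
           \<and> (\<forall>k. q k \<noteq> 0 \<longrightarrow> k < 2 ^ n \<and> near_grid (A j0) L n k)"
    using frostman_pinned[OF AL L assms(4,5)] by blast
  define C where "C = C0 + (\<Sum>j\<in>UNIV. Cf j)"
  have Cf0: "0 \<le> Cf j" for j using Cf[of j] by linarith
  have C_ge: "C0 \<le> C" "Cf j \<le> C" for j
  proof -
    have "Cf j \<le> (\<Sum>j\<in>UNIV. Cf j)" by (rule member_le_sum) (auto simp: Cf0)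
    then show "Cf j \<le> C" using C0 by (simp add: C_def)
    show "C0 \<le> C" by (simp add: C_def sum_nonneg Cf0)
  qed
  \<comment> \<open>\<open>grid_weights.A\<close> takes only \<open>J\<close> and \<open>C\<close>,
    so \<open>K\<close> is fixed before the scale and the weights are chosen.\<close>
  define K where "K = 8 * (1 + grid_weights.A J C / (1 - (1 / 2) powr \<eta>))"

  \<comment> \<open>\<open>t\<close> is a squared distance between grid points and \<open>b\<close>
    its cell. Grid points are only near \<open>E\<close>, hence the error against a true
    distance.\<close>
  have cells: "\<exists>S. finite S \<and> 2 ^ n \<le> K * real (card S) \<and>
      (\<forall>b\<in>S. \<exists>r\<in>distance_set E. \<exists>t. \<bar>(r / (2 * L))\<^sup>2 - t\<bar> \<le> 4 * d / 2 ^ n \<and> b = \<lfloor>2 ^ n * t\<rfloor>)"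
    if n: "n0 \<le> n" for n
  proof -
    obtain p where p: "\<And>j. frostman_weight n (\<lambda>k. real k / 2 ^ n) (s j) (Cf j) (p j)"
      and p_supp: "\<And>j k. p j k \<noteq> 0 \<Longrightarrow> k < 2 ^ n \<and> near_grid (A j) L n k"
      using Cfp[of n] by metis
    obtain a q where a: "a < 2 ^ n" "near_grid (A j0) L n a"
      and q: "frostman_weight n (\<lambda>k. (real k / 2 ^ n - real a / 2 ^ n)\<^sup>2) (s j0) C0 q"
      and q_supp: "\<And>k. q k \<noteq> 0 \<Longrightarrow> k < 2 ^ n \<and> near_grid (A j0) L n k"
      using C0q[OF n] by blast
    define v where "v k = (real k / 2 ^ n - real a / 2 ^ n)\<^sup>2" for k
    note p' = frostman_weight_mono[OF p C_ge(2)] and q' = frostman_weight_mono[OF q C_ge(1), folded v_def]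
    interpret W: grid_weights J n p q v s "s j0" C
    proof
      show "1 \<le> C" using C0 C_ge(1) by linarith
      show "0 \<le> v k \<and> v k \<le> 1" if "k < 2 ^ n" for k
      proof -
        have unit: "0 \<le> real m / 2 ^ n \<and> real m / 2 ^ n \<le> 1" if "m < 2 ^ n" for m
        proof -
          have "real m \<le> 2 ^ n" using that by (simp add: less_imp_le)
          then show ?thesis by simp
        qed
        have "\<bar>real k / 2 ^ n - real a / 2 ^ n\<bar> \<le> 1" using unit[OF that] unit[OF a(1)] by linarith
        then show ?thesis by (simp add: v_def abs_square_le_1)
      qed
    qed (use p' q' UJ(3) in \<open>auto simp: frostman_weight_def\<close>)
    obtain y where y: "y \<in> W.Y" "0 < W.\<nu> y"
      and many: "real W.N \<le> K * real (card ((\<lambda>x. \<lfloor>real W.N * W.f y x\<rfloor>) ` {x \<in> W.X. 0 < W.\<mu> x}))"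
      using W.many_bins[OF \<eta>[unfolded \<eta>_def]] unfolding K_def \<eta>_def by blast
    have supp: "x j < 2 ^ n \<and> near_grid (A j) L n (x j)" if "0 < W.\<nu> x" "j \<in> J" for x j
    proof (rule p_supp)
      show "p j (x j) \<noteq> 0"
      proof
        assume "p j (x j) = 0"
        then have "W.\<nu> x = 0" unfolding W.\<nu>_def using that(2) UJ(3) by (auto simp: prod_zero_iff)
        then show False using that(1) by simp
      qed
    qed
    show ?thesis
    proof (intro exI conjI ballI)
      let ?S = "(\<lambda>x. \<lfloor>real W.N * W.f y x\<rfloor>) ` {x \<in> W.X. 0 < W.\<mu> x}"
      show "finite ?S" using W.finite_X by simp
      show "2 ^ n \<le> K * real (card ?S)" using many by (simp add: W.real_N)
      fix b assume "b \<in> ?S"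
      then obtain x k where xk: "(x, k) \<in> W.X" "0 < W.\<mu> (x, k)" and b: "b = \<lfloor>real W.N * W.f y (x, k)\<rfloor>" by auto
      have pos: "0 < W.\<nu> x" "q k \<noteq> 0"
        using xk(2) W.\<nu>_nonneg[of x] W.q_nonneg[of k] by (auto simp: W.\<mu>_def zero_less_mult_iff)
      define kx where "kx j = (if j = j0 then k else x j)" for j
      define ky where "ky j = (if j = j0 then a else y j)" for j
      have kx: "kx j < 2 ^ n \<and> near_grid (A j) L n (kx j)" for j
        using q_supp[OF pos(2)] supp[OF pos(1), of j] by (auto simp: kx_def J_def)
      have ky: "ky j < 2 ^ n \<and> near_grid (A j) L n (ky j)" for j
        using a supp[OF y(2), of j] by (auto simp: ky_def J_def)
      have "W.f y (x, k) = (\<Sum>j\<in>UNIV. (real (kx j) / 2 ^ n - real (ky j) / 2 ^ n)\<^sup>2)"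
      proof -
        have "(\<Sum>j\<in>J. (real (kx j) / 2 ^ n - real (ky j) / 2 ^ n)\<^sup>2) = (\<Sum>j\<in>J. (real (x j) / 2 ^ n - real (y j) / 2 ^ n)\<^sup>2)"
          by (intro sum.cong refl) (auto simp: kx_def ky_def J_def)
        then show ?thesis
          unfolding UJ(1) W.f_def W.real_N using UJ(2,3) by (simp add: v_def kx_def ky_def)
      qed
      moreover have "\<exists>r\<in>distance_set E.
          \<bar>(r / (2 * L))\<^sup>2 - (\<Sum>j\<in>UNIV. (real (kx j) / 2 ^ n - real (ky j) / 2 ^ n)\<^sup>2)\<bar> \<le> 4 * d / 2 ^ n"
        unfolding assms(3) d_def by (rule grid_distance_near) (use L AL kx ky in auto)
      ultimately show "\<exists>r\<in>distance_set E. \<exists>t. \<bar>(r / (2 * L))\<^sup>2 - t\<bar> \<le> 4 * d / 2 ^ n \<and> b = \<lfloor>2 ^ n * t\<rfloor>"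
        using b unfolding W.real_N by metis
    qed
  qed

  have K0: "0 < K"
  proof -
    obtain S :: "int set" where "2 ^ n0 \<le> K * real (card S)" using cells[OF order_refl] by blast
    moreover have "(0::real) < 2 ^ n0" by simp
    ultimately have "0 < K * real (card S)" by linarith
    then show ?thesis by (simp add: zero_less_mult_iff)
  qed

  have compD: "compact (distance_set E)" by (rule compact_distance_set[OF assms(2)])
  define Q where "Q = (\<lambda>r. (r / (2 * L))\<^sup>2) ` distance_set E"
  have compQ: "compact Q"
    unfolding Q_def by (intro compact_continuous_image continuous_intros compD) (use L in auto)
  have "distance_set E \<in> sets lebesgue" using compD by (simp add: lmeasurable_compact fmeasurableD)
  then have "negligible (distance_set E)" using null by (simp add: negligible_iff_emeasure0)
  \<comment> \<open>The counted cells contain squares of distances, so nullity has to pass through a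
    differentiable map.\<close>
  then have "negligible Q"
    unfolding Q_def
    by (rule negligible_differentiable_image_negligible[OF order_refl]) (use L in \<open>auto simp: differentiable_on_def intro!: derivative_intros\<close>)
  moreover have borelQ: "Q \<in> sets borel" using compQ by (rule borel_compact)
  moreover have "Q \<in> sets lebesgue" using compQ by (simp add: lmeasurable_compact fmeasurableD)
  ultimately have Q0: "emeasure lborel Q = 0"
    by (simp add: negligible_iff_emeasure0)
  \<comment> \<open>At least \<open>2 ^ n / K\<close> disjoint cells of length
    \<open>1 / 2 ^ n\<close> fill measure \<open>1 / K\<close>, more than \<open>U\<close> can
    hold.\<close>
  obtain U where U: "open U" "Q \<subseteq> U" and eU: "emeasure lborel (U - Q) < ennreal (1 / K)"
    using outer_regular_lborel[OF borelQ, of "1 / K"] K0 by auto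
  have "emeasure lborel U \<le> emeasure lborel (U - Q) + emeasure lborel Q"
  proof -
    have "emeasure lborel ((U - Q) \<union> Q) \<le> emeasure lborel (U - Q) + emeasure lborel Q"
      by (rule emeasure_subadditive) (use U(1) borelQ in auto)
    moreover have "(U - Q) \<union> Q = U" using U(2) by blast
    ultimately show ?thesis by simp
  qed
  then have U_small: "emeasure lborel U < ennreal (1 / K)" using eU Q0 by simp
  obtain \<epsilon> where \<epsilon>: "0 < \<epsilon>" and ball: "(\<Union>x\<in>Q. ball x \<epsilon>) \<subseteq> U"
    by (rule compact_subset_open_imp_ball_epsilon_subset[OF compQ U])
  \<comment> \<open>Room for \<open>4 * d\<close> mesh lengths between a true squared distance and
    \<open>t\<close>, and for one more to reach any point of the cell of \<open>t\<close>.\<close>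
  obtain m where m: "(1 / 2 :: real) ^ m < \<epsilon> / (4 * d + 1)"
    using real_arch_pow_inv[of "\<epsilon> / (4 * d + 1)" "1 / 2"] \<epsilon> d1 by auto
  define n where "n = max m n0"
  have "(1 / 2 :: real) ^ n \<le> (1 / 2) ^ m" by (rule power_decreasing) (auto simp: n_def)
  then have "(1 / 2 :: real) ^ n * (4 * d + 1) \<le> (1 / 2) ^ m * (4 * d + 1)"
    using d1 by (intro mult_right_mono) auto
  also have "\<dots> < \<epsilon>" using m d1 by (simp add: pos_less_divide_eq)
  finally have "(1 / 2 :: real) ^ n * (4 * d + 1) < \<epsilon>" .
  moreover have "4 * d / 2 ^ n + 1 / 2 ^ n = (1 / 2) ^ n * (4 * d + 1)"
    by (simp add: power_one_over flip: add_divide_distrib)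
  ultimately have n_small: "4 * d / 2 ^ n + 1 / 2 ^ n < \<epsilon>" by simp
  obtain S :: "int set" where S: "finite S" "2 ^ n \<le> K * real (card S)"
    and near: "\<And>b. b \<in> S \<Longrightarrow> \<exists>r\<in>distance_set E. \<exists>t. \<bar>(r / (2 * L))\<^sup>2 - t\<bar> \<le> 4 * d / 2 ^ n \<and> b = \<lfloor>2 ^ n * t\<rfloor>"
    using cells[of n] by (auto simp: n_def)
  have "{of_int b / 2 ^ n..<(of_int b + 1) / 2 ^ n} \<subseteq> U" if b: "b \<in> S" for b
  proof
    fix w :: real assume w: "w \<in> {of_int b / 2 ^ n..<(of_int b + 1) / 2 ^ n}"
    obtain r t where r: "r \<in> distance_set E" and t: "\<bar>(r / (2 * L))\<^sup>2 - t\<bar> \<le> 4 * d / 2 ^ n" and bt: "b = \<lfloor>2 ^ n * t\<rfloor>"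
      using near[OF b] by blast
    have "of_int b \<le> 2 ^ n * t" "2 ^ n * t < of_int b + 1" unfolding bt by linarith+
    then have "of_int b / 2 ^ n \<le> t" "t < (of_int b + 1) / 2 ^ n"
      by (simp_all add: pos_divide_le_eq pos_less_divide_eq mult.commute)
    then have "\<bar>t - w\<bar> < 1 / 2 ^ n" using w by (auto simp: add_divide_distrib abs_less_iff)
    then have "\<bar>(r / (2 * L))\<^sup>2 - w\<bar> < \<epsilon>" using t n_small by linarith
    then have "w \<in> ball ((r / (2 * L))\<^sup>2) \<epsilon>" by (simp add: dist_real_def)
    then show "w \<in> U" using ball r unfolding Q_def by blast
  qed
  then have "ennreal (real (card S) / 2 ^ n) \<le> emeasure lborel U"
    using S(1) U(1) by (intro emeasure_grid_cells_le) auto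
  moreover have "ennreal (1 / K) \<le> ennreal (real (card S) / 2 ^ n)"
    using S(2) K0 by (intro ennreal_leI) (simp add: field_simps)
  ultimately have "ennreal (1 / K) \<le> emeasure lborel U" by (rule order_trans[rotated])
  then show False using U_small by (simp add: not_le[symmetric])
qed

end
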